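(* Let $\mathcal{A}$ be a finite Abelian group, $p$ a prime, $k\ge1$, and $t:\mathcal{A}^3\to\mathbb{Z}_{p^k}$. Let $N$ be the minimal positive integer for which there are functions $a,b,c:\mathcal{A}\to\mathbb{Z}_{p^kN}$ with $a(x)+b(y)+c(z)=N\cdot t(x,y,z)\pmod{p^kN}$ for all $(x,y,z)\in\mathcal{A}^3$ with $x+y+z=0$, and suppose such $N$ exists and $N>1$. Then there is a constant $c=c(t,\mathcal{A})>0$ such that for all $n$ and all $f,g,h:\mathcal{A}^n\to\mathbb{Z}_{p^k}^n$, $$\Pr_{\substack{(x,y,z)\in(\mathcal{A}^n)^3\\ x+y+z=0}}\big[f(x)_i+g(y)_i+h(z)_i=t(x_i,y_i,z_i)\pmod{p^k},\ i=1,\dots,n\big]\le 2^{-cn},$$ where $(x,y,z)$ is uniform among triples in $(\mathcal{A}^n)^3$ with $x+y+z=0$. *)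

theory Defs
  imports Complex_Main "HOL-Library.FuncSet" "HOL-Number_Theory.Cong"
begin

text \<open>Elements of \<open>\<Z>_m\<close> are represented by integers, compared modulo m.
  The finite Abelian group \<open>\<A>\<close> is a type \<open>'a :: {ab_group_add, finite}\<close>.\<close>

definition admissible_N :: "nat \<Rightarrow> nat \<Rightarrow> ('a::ab_group_add \<Rightarrow> 'a \<Rightarrow> 'a \<Rightarrow> int) \<Rightarrow> nat \<Rightarrow> bool" where
  "admissible_N p k t N \<longleftrightarrow>
     (\<exists>a b c :: 'a \<Rightarrow> int. \<forall>x y z. x + y + z = 0 \<longrightarrow>
        [a x + b y + c z = int N * t x y z] (mod int (p ^ k * N)))"

definition vecs :: "nat \<Rightarrow> (nat \<Rightarrow> 'a) set" where
  "vecs n = {..<n} \<rightarrow>\<^sub>E (UNIV :: 'a set)"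

definition zero_sum_triples :: "nat \<Rightarrow> ((nat \<Rightarrow> 'a::ab_group_add) \<times> (nat \<Rightarrow> 'a) \<times> (nat \<Rightarrow> 'a)) set" where
  "zero_sum_triples n = {(x, y, z). x \<in> vecs n \<and> y \<in> vecs n \<and> z \<in> vecs n \<and>
       (\<forall>i<n. x i + y i + z i = 0)}"

text \<open>Success probability of \<open>f,g,h : \<A>^n \<rightarrow> \<Z>_{p^k}^n\<close> (outputs as \<open>nat \<Rightarrow> int\<close>,
  coordinates \<open>i < n\<close> relevant), for uniform zero-sum triples.\<close>
definition success_prob ::
  "nat \<Rightarrow> nat \<Rightarrow> ('a::ab_group_add \<Rightarrow> 'a \<Rightarrow> 'a \<Rightarrow> int) \<Rightarrow> nat \<Rightarrow>
   ((nat \<Rightarrow> 'a) \<Rightarrow> nat \<Rightarrow> int) \<Rightarrow> ((nat \<Rightarrow> 'a) \<Rightarrow> nat \<Rightarrow> int) \<Rightarrow> ((nat \<Rightarrow> 'a) \<Rightarrow> nat \<Rightarrow> int) \<Rightarrow> real" where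
  "success_prob p k t n f g h =
     real (card {(x, y, z) \<in> zero_sum_triples n.
        \<forall>i<n. [f x i + g y i + h z i = t (x i) (y i) (z i)] (mod int (p ^ k))})
     / real (card (zero_sum_triples n :: ((nat \<Rightarrow> 'a) \<times> (nat \<Rightarrow> 'a) \<times> (nat \<Rightarrow> 'a)) set))"

end

theory Submission
  imports Defs "HOL-Library.Set_Algebras" "HOL-Library.Function_Algebras" "HOL-Library.Product_Plus"
begin

text \<open>Write \<open>q = p^k\<close>. Dividing the functions \<open>a, b, c\<close> by \<open>q N\<close> turns the hypothesis into a solution of
  \<open>a + b + c = t / q\<close> in the circle group; then \<open>q a\<close> is a homomorphism \<open>\<alpha>\<close> up to a constant.
  If \<open>\<alpha>\<close> vanished on the \<open>q\<close>-torsion of \<open>\<A>\<close>, it would be \<open>q\<close> times a homomorphism, because the circle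
  is divisible, and subtracting that homomorphism would give \<open>N = 1\<close>. So \<open>\<alpha>\<close> is nonzero somewhere on
  the \<open>q\<close>-torsion.

  Let \<open>F x i = a (x i) - f x i / q\<close>, and define \<open>G\<close>, \<open>H\<close> likewise. A successful triple is a zero-sum triple of points
  on the graphs of \<open>F\<close>, \<open>G\<close>, \<open>H\<close>, so success probability \<open>\<epsilon>\<close> gives, by Balog-Szemeredi-Gowers and Pluennecke,
  a piece \<open>A'\<close> of the graph of \<open>F\<close> with density \<open>\<epsilon> / 2\<close> whose \<open>q\<close>-fold sumset is small up to powers of \<open>1 / \<epsilon>\<close>.
  That sumset contains the dilate \<open>q A'\<close>, and \<open>q F x = \<alpha> x + const\<close> does not involve \<open>f\<close>: over each value of \<open>q x\<close>
  it takes exponentially many values, which forces \<open>\<epsilon>\<close> to be exponentially small.\<close>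

section \<open>Multiples and sumset growth\<close>

text \<open>Defined on commutative monoids so that it serves group elements, functions and pairs,
  and also sets under Minkowski addition, where \<open>nmul n S\<close> is the n-fold sumset and not
  the dilate.\<close>

definition nmul :: "nat \<Rightarrow> 'b::comm_monoid_add \<Rightarrow> 'b" where
  "nmul n x = (\<Sum>i<n. x)"

lemma nmul_0 [simp]: "nmul 0 x = 0"
  by (simp add: nmul_def)

lemma nmul_Suc [simp]: "nmul (Suc n) x = x + nmul n x"
  by (simp add: nmul_def add.commute)

lemma nmul_zero [simp]: "nmul n 0 = 0"
  by (simp add: nmul_def)

lemma nmul_add_right: "nmul n (x + y) = nmul n x + nmul n y"
  by (simp add: nmul_def sum.distrib)

lemma nmul_add_left: "nmul (m + n) x = nmul m x + nmul n x"
  by (induction m) (simp_all add: add.assoc)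

lemma nmul_mult: "nmul (m * n) x = nmul m (nmul n x)"
  by (induction m) (simp_all add: nmul_add_left)

lemma nmul_div_mod: "nmul n x = nmul (n div r) (nmul r x) + nmul (n mod r) x"
  by (simp flip: nmul_add_left nmul_mult)

lemma nmul_minus: "nmul n (- x) = - nmul n (x :: 'b::ab_group_add)"
  by (simp add: nmul_def sum_negf)

lemma nmul_diff: "nmul n (x - y) = nmul n x - nmul n (y :: 'b::ab_group_add)"
  by (simp add: nmul_def sum_subtractf)

lemma nmul_apply: "nmul n f i = nmul n (f i)"
  by (induction n) simp_all

lemma nmul_Pair: "nmul n (x, y) = (nmul n x, nmul n y)"
  by (induction n) (simp_all add: zero_prod_def)

text \<open>Diagonal sums: the dilate by \<open>n\<close> sits inside the n-fold sumset, whose size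
  \<open>pluennecke\<close> controls.\<close>

lemma nmul_in_set_nmul: "x \<in> S \<Longrightarrow> nmul n x \<in> nmul n S"
  by (induction n) (auto intro: set_plus_intro)

lemma finite_set_nmul: "finite S \<Longrightarrow> finite (nmul n S)"
  by (induction n) (auto intro: finite_set_plus)

lemma nmul_eq_0_in_finite_group:
  fixes x :: "'a::{ab_group_add, finite}"
  shows "\<exists>r>0. nmul r x = 0"
proof -
  have "\<not> inj (\<lambda>n. nmul n x)"
    using finite_subset[OF subset_UNIV finite] finite_imageD by blast
  then obtain m n where mn: "m < n" "nmul m x = nmul n x"
    by (metis injI linorder_neqE_nat)
  have "nmul n x = nmul (n - m) x + nmul m x"
    using mn(1) by (simp flip: nmul_add_left)
  then have "nmul (n - m) x = 0" using mn(2) by simp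
  then show ?thesis using mn(1) by (metis zero_less_diff)
qed

text \<open>Petridis: adding the elements of \<open>C\<close> one at a time preserves the inequality, since the
  translates \<open>x + c + B\<close> that bring nothing new are at least as many as the points \<open>x + c\<close>
  that bring nothing new.\<close>

lemma petridis:
  fixes X B C :: "'b::ab_group_add set" and K :: real
  assumes "finite X" "finite B" "finite C" "K \<ge> 0"
    and min: "\<And>Z. Z \<subseteq> X \<Longrightarrow> K * card Z \<le> card (Z + B)"
    and eq: "card (X + B) \<le> K * card X"
  shows "card (X + B + C) \<le> K * card (X + C)"
  using \<open>finite C\<close>
proof (induction C rule: finite_induct)
  case empty
  then show ?case by (simp add: set_plus_def)
next
  case (insert c C)
  define Z where "Z = {x\<in>X. \<forall>b\<in>B. x + b + c \<in> X + B + C}"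
  define W where "W = {x\<in>X. x + c \<in> X + C}"
  have fin: "finite (X + B)" "finite (Z + B)" "finite (X + B + C)" "finite (X + C)"
    using assms insert by (auto intro!: finite_set_plus simp: Z_def)
  have sub: "Z \<subseteq> X" "W \<subseteq> X" by (auto simp: Z_def W_def)
  have "W \<subseteq> Z"
  proof
    fix x assume "x \<in> W"
    then obtain x' c' where x: "x \<in> X" "x' \<in> X" "c' \<in> C" "x + c = x' + c'"
      by (auto simp: W_def elim: set_plus_elim)
    have "x + b + c \<in> X + B + C" if "b \<in> B" for b
    proof -
      have "x + b + c = x' + b + c'" using x(4) by (metis add.commute add.left_commute)
      then show ?thesis using x that by (metis set_plus_intro)
    qed
    then show "x \<in> Z" using x(1) by (auto simp only: Z_def)
  qed
  have ZB: "Z + B \<subseteq> X + B" using sub by (auto elim!: set_plus_elim intro!: set_plus_intro)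
  \<comment> \<open>A sum that uses \<open>c\<close> can be new only if \<open>x + b\<close> lies
    outside \<open>Z + B\<close>, so at most \<open>card (X + B) - card (Z + B)\<close> elements are
    gained.\<close>
  have "X + B + insert c C \<subseteq> (X + B + C) \<union> (\<lambda>u. u + c) ` ((X + B) - (Z + B))"
  proof
    fix u assume "u \<in> X + B + insert c C"
    then obtain x b d where u: "u = x + b + d" "x \<in> X" "b \<in> B" "d \<in> insert c C"
      by (auto elim!: set_plus_elim)
    consider "d \<in> C" | "d = c" "x + b \<in> Z + B" | "d = c" "x + b \<notin> Z + B" using u(4) by blast
    then show "u \<in> (X + B + C) \<union> (\<lambda>u. u + c) ` ((X + B) - (Z + B))"
    proof cases
      case 1
      then show ?thesis using u by (metis set_plus_intro UnI1)
    next
      case 2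
      then obtain z b' where z: "x + b = z + b'" "z \<in> Z" "b' \<in> B" by (auto elim: set_plus_elim)
      then have "z + b' + c \<in> X + B + C" by (auto simp only: Z_def)
      then show ?thesis unfolding u(1) 2(1) z(1) by (rule UnI1)
    next
      case 3
      then have "x + b \<in> (X + B) - (Z + B)" using u(2,3) by (metis set_plus_intro DiffI)
      then show ?thesis unfolding u(1) 3(1) by (intro UnI2 imageI)
    qed
  qed
  then have "card (X + B + insert c C) \<le> card ((X + B + C) \<union> (\<lambda>u. u + c) ` ((X + B) - (Z + B)))"
    using fin by (intro card_mono) auto
  also have "\<dots> \<le> card (X + B + C) + card ((\<lambda>u. u + c) ` ((X + B) - (Z + B)))"
    by (rule card_Un_le)
  also have "card ((\<lambda>u. u + c) ` ((X + B) - (Z + B))) = card (X + B) - card (Z + B)"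
    using fin ZB by (subst card_image) (auto simp: inj_on_def card_Diff_subset)
  finally have "real (card (X + B + insert c C)) \<le> card (X + B + C) + (card (X + B) - card (Z + B))"
    using card_mono[OF fin(1) ZB] by linarith
  \<comment> \<open>Here \<open>eq\<close> bounds \<open>X + B\<close> from above and
    \<open>min\<close>, applied to \<open>Z\<close>, bounds \<open>Z + B\<close> from below.\<close>
  also have "\<dots> \<le> K * card (X + C) + K * card X - K * card Z"
    using insert.IH eq min[OF sub(1)] card_mono[OF fin(1) ZB] by (simp add: of_nat_diff)
  also have "\<dots> \<le> K * card (X + C) + K * card X - K * card W"
    using card_mono[OF finite_subset[OF sub(1) assms(1)] \<open>W \<subseteq> Z\<close>] assms(4)
    by (simp add: mult_left_mono)
  also have "\<dots> = K * (card (X + C) + card (X - W))"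
    using sub assms(1) finite_subset[OF sub(2)] card_mono[OF assms(1) sub(2)]
    by (simp add: card_Diff_subset of_nat_diff algebra_simps)
  \<comment> \<open>By the choice of \<open>W\<close>, the shifts by \<open>c\<close> of the points
    outside \<open>W\<close> avoid \<open>X + C\<close>, so the count is exact.\<close>
  also have "card (X + C) + card (X - W) = card ((X + C) \<union> (\<lambda>x. x + c) ` (X - W))"
    using fin assms(1) by (subst card_Un_disjoint) (auto simp: card_image inj_on_def W_def)
  also have "(X + C) \<union> (\<lambda>x. x + c) ` (X - W) = X + insert c C"
    unfolding W_def set_plus_def by blast
  finally show ?case by simp
qed

text \<open>Choose \<open>X\<close> to minimise \<open>card (Z + B) / card Z\<close> over nonempty
  subsets \<open>Z\<close> of \<open>A\<close>. The minimal ratio \<open>L\<close> is at most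
  \<open>K\<close>, and its minimality is the hypothesis of \<open>petridis\<close>; taking the
  j-fold sumset of \<open>B\<close> for \<open>C\<close> gains one factor \<open>L\<close> per
  step.\<close>

lemma pluennecke:
  fixes A B :: "'b::ab_group_add set" and K :: real
  assumes "finite A" "A \<noteq> {}" "finite B" and K: "card (A + B) \<le> K * card A"
  shows "\<exists>X\<subseteq>A. X \<noteq> {} \<and> (\<forall>j. card (X + nmul j B) \<le> K ^ j * card X)"
proof -
  define \<phi> where "\<phi> Z = real (card (Z + B)) / card Z" for Z
  have "finite (Pow A - {{}})" "Pow A - {{}} \<noteq> {}" using assms by auto
  then obtain X where X: "X \<in> Pow A - {{}}" "\<forall>Z\<in>Pow A - {{}}. \<phi> X \<le> \<phi> Z"
    using ex_min_if_finite[of "\<phi> ` (Pow A - {{}})"] by (auto simp: not_less)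
  have X': "X \<subseteq> A" "X \<noteq> {}" "finite X" using X assms finite_subset by auto
  have cX: "card X > 0" using X' by (simp add: card_gt_0_iff)
  have cA: "card A > 0" using assms by (simp add: card_gt_0_iff)
  define L where "L = \<phi> X"
  have "L \<le> \<phi> A" using X assms by (auto simp: L_def)
  also have "\<dots> \<le> K" using K cA by (simp add: \<phi>_def divide_le_eq)
  finally have LK: "L \<le> K" .
  have L0: "L \<ge> 0" by (simp add: L_def \<phi>_def)
  have min: "L * card Z \<le> card (Z + B)" if "Z \<subseteq> X" for Z
  proof (cases "Z = {}")
    case False
    then have "L \<le> \<phi> Z" using X that by (auto simp: L_def)
    moreover have "card Z > 0" using False that X' finite_subset by (auto simp: card_gt_0_iff)
    ultimately show ?thesis by (simp add: \<phi>_def le_divide_eq)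
  qed auto
  have eq: "card (X + B) \<le> L * card X" using cX by (simp add: L_def \<phi>_def)
  have "card (X + nmul j B) \<le> L ^ j * card X" for j
  proof (induction j)
    case (Suc j)
    have "card (X + nmul (Suc j) B) \<le> L * card (X + nmul j B)"
      using petridis[OF X'(3) assms(3) finite_set_nmul[OF assms(3)] L0 min eq] 
      by (simp add: add.assoc)
    also have "\<dots> \<le> L * (L ^ j * card X)" using Suc L0 by (intro mult_left_mono)
    finally show ?case by simp
  qed simp
  moreover have "L ^ j * card X \<le> K ^ j * card X" for j
    using L0 LK by (intro mult_right_mono power_mono) auto
  ultimately show ?thesis using X' by (meson order_trans)
qed

section \<open>A one-sided Balog-Szemeredi-Gowers theorem\<close>

text \<open>Averaging over \<open>b\<close>: a pair with few common neighbours lies in few neighbourhoods.\<close>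

lemma dense_neighbourhood:
  fixes E :: "('b \<times> 'c) set" and \<epsilon> M :: real
  defines "codeg a a' \<equiv> card {b. (a, b) \<in> E \<and> (a', b) \<in> E}"
  assumes fin: "finite A" "finite B" and E: "E \<subseteq> A \<times> B"
    and card: "card A \<le> M" "card B \<le> M" "card E \<ge> \<epsilon> * M\<^sup>2" and pos: "\<epsilon> > 0" "M > 0"
  shows "\<exists>b\<in>B. \<epsilon>\<^sup>2 * M\<^sup>2 / 2 + 16 * card {(a, a'). (a, b) \<in> E \<and> (a', b) \<in> E \<and> codeg a a' < \<epsilon>\<^sup>2 / 32 * M}
    \<le> (card {a. (a, b) \<in> E})\<^sup>2"
proof (rule ccontr)
  define bad where "bad = {(a, a') \<in> A \<times> A. codeg a a' < \<epsilon>\<^sup>2 / 32 * M}"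
  define N where "N b = {a. (a, b) \<in> E}" for b
  define bd where "bd b = {(a, a'). (a, b) \<in> E \<and> (a', b) \<in> E \<and> codeg a a' < \<epsilon>\<^sup>2 / 32 * M}" for b
  assume "\<not> ?thesis"
  then have neg: "real (card (N b))^2 - 16 * card (bd b) < \<epsilon>\<^sup>2 * M\<^sup>2 / 2" if "b \<in> B" for b
    using that by (auto simp: N_def bd_def)
  have finE: "finite E" using E fin finite_subset by blast
  have finN: "finite (N b)" for b using E fin by (auto simp: N_def intro: finite_subset[of _ A])
  have finbad: "finite bad" using fin by (auto simp: bad_def intro: finite_subset[of _ "A \<times> A"])
  have bdeq: "bd b = {x\<in>bad. (fst x, b) \<in> E \<and> (snd x, b) \<in> E}" for b
    using E by (auto simp: bd_def bad_def)
  have "card E = card (Sigma B N)"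
    using E by (intro bij_betw_same_card[of prod.swap]) (force simp: bij_betw_def N_def image_iff)
  then have sumN: "card E = (\<Sum>b\<in>B. card (N b))"
    using fin finN by simp
  have "(\<Sum>b\<in>B. card (bd b)) = (\<Sum>b\<in>B. \<Sum>x\<in>bad. if (fst x, b) \<in> E \<and> (snd x, b) \<in> E then 1 else 0)"
    using finbad by (simp add: bdeq flip: sum.inter_filter)
  also have "\<dots> = (\<Sum>x\<in>bad. \<Sum>b\<in>B. if (fst x, b) \<in> E \<and> (snd x, b) \<in> E then 1 else 0)"
    by (rule sum.swap)
  also have "\<dots> = (\<Sum>x\<in>bad. codeg (fst x) (snd x))"
  proof (intro sum.cong refl)
    fix x
    have "{b. (fst x, b) \<in> E \<and> (snd x, b) \<in> E} = {b\<in>B. (fst x, b) \<in> E \<and> (snd x, b) \<in> E}"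
      using E by auto
    then show "(\<Sum>b\<in>B. if (fst x, b) \<in> E \<and> (snd x, b) \<in> E then 1 else 0) = codeg (fst x) (snd x)"
      using fin by (simp add: codeg_def flip: sum.inter_filter)
  qed
  finally have "real (\<Sum>b\<in>B. card (bd b)) = (\<Sum>x\<in>bad. real (codeg (fst x) (snd x)))" by simp
  also have "\<dots> \<le> (\<Sum>x\<in>bad. \<epsilon>\<^sup>2 / 32 * M)" by (intro sum_mono) (auto simp: bad_def)
  also have "\<dots> = card bad * (\<epsilon>\<^sup>2 / 32 * M)" by simp
  also have "\<dots> \<le> M\<^sup>2 * (\<epsilon>\<^sup>2 / 32 * M)"
  proof (intro mult_right_mono)
    have "card bad \<le> card (A \<times> A)" using fin by (intro card_mono) (auto simp: bad_def)
    then have "real (card bad) \<le> real (card A) * real (card A)"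
      by (simp add: card_cartesian_product flip: of_nat_mult)
    also have "\<dots> \<le> M * M" using card(1) pos by (intro mult_mono) auto
    finally show "card bad \<le> M\<^sup>2" by (simp add: power2_eq_square)
  qed (use pos in auto)
  finally have sumbd: "(\<Sum>b\<in>B. real (card (bd b))) \<le> M^3 * \<epsilon>\<^sup>2 / 32"
    by (simp add: power2_eq_square power3_eq_cube algebra_simps)
  \<comment> \<open>Cauchy-Schwarz in expanded form, with the degrees compared to
    \<open>\<epsilon> * M\<close>.\<close>
  have "0 \<le> (\<Sum>b\<in>B. (real (card (N b)) - \<epsilon> * M)\<^sup>2)" by (intro sum_nonneg) auto
  also have "\<dots> = (\<Sum>b\<in>B. real (card (N b))^2 - (2 * \<epsilon> * M) * card (N b) + (\<epsilon> * M)^2)"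
    by (intro sum.cong refl) (simp add: power2_diff algebra_simps)
  also have "\<dots> = (\<Sum>b\<in>B. real (card (N b))^2) - 2 * \<epsilon> * M * card E + card B * (\<epsilon> * M)^2"
    by (simp add: sum.distrib sum_subtractf sumN sum_distrib_left)
  finally have "2 * \<epsilon> * M * card E - card B * (\<epsilon> * M)^2 \<le> (\<Sum>b\<in>B. real (card (N b))^2)" by simp
  moreover have "2 * \<epsilon> * M * (\<epsilon> * M\<^sup>2) \<le> 2 * \<epsilon> * M * card E"
    using card(3) pos by (intro mult_left_mono) auto
  moreover have "card B * (\<epsilon> * M)^2 \<le> M * (\<epsilon> * M)^2"
    using card(2) by (intro mult_right_mono) auto
  ultimately have sumsq: "\<epsilon>\<^sup>2 * M^3 \<le> (\<Sum>b\<in>B. real (card (N b))^2)"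
    by (simp add: power2_eq_square power3_eq_cube algebra_simps)
  \<comment> \<open>Weight 16 times threshold 1/32 is 1/2: bad pairs cost at most half of the lower
    bound \<open>\<epsilon>\<^sup>2 * M^3\<close>, and the remaining half contradicts
    \<open>neg\<close> summed over at most \<open>M\<close> vertices.\<close>
  have "\<epsilon>\<^sup>2 * M^3 / 2 \<le> (\<Sum>b\<in>B. real (card (N b))^2) - 16 * (\<Sum>b\<in>B. real (card (bd b)))"
    using sumsq sumbd by (simp add: mult.commute)
  also have "\<dots> = (\<Sum>b\<in>B. real (card (N b))^2 - 16 * card (bd b))"
    by (simp add: sum_subtractf sum_distrib_left)
  also have "\<dots> < (\<Sum>b\<in>B. \<epsilon>\<^sup>2 * M\<^sup>2 / 2)"
  proof (rule sum_strict_mono[OF fin(2)])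
    have "card E > 0" using card(3) pos by (smt (verit) mult_pos_pos of_nat_0_less_iff zero_less_power)
    then show "B \<noteq> {}" using sumN by auto
  qed (rule neg)
  also have "\<dots> = card B * (\<epsilon>\<^sup>2 * M\<^sup>2 / 2)" by simp
  also have "\<dots> \<le> M * (\<epsilon>\<^sup>2 * M\<^sup>2 / 2)" using card(2) by (intro mult_right_mono) auto
  finally show False by (simp add: power2_eq_square power3_eq_cube algebra_simps)
qed

text \<open>Inside a neighbourhood \<open>P\<close> with few bad pairs, \<open>A'\<close> keeps the
  vertices with few bad partners. Two of them, \<open>a\<close> and \<open>a'\<close>, are joined by
  many paths \<open>a, b, u, b', a'\<close>, and each path writes \<open>a - a'\<close> as
  \<open>(a + b) - (u + b) - (a' + b') + (u + b')\<close> with all four terms in \<open>C\<close>.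
  There are at most \<open>M ^ 4\<close> such quadruples, hence few differences.\<close>

lemma balog_szemeredi_gowers:
  fixes A B C :: "'b::ab_group_add set" and \<epsilon> M :: real
  assumes fin: "finite A" "finite B" "finite C" and E: "E \<subseteq> A \<times> B"
    and sum: "\<And>a b. (a, b) \<in> E \<Longrightarrow> a + b \<in> C"
    and card: "card A \<le> M" "card B \<le> M" "card C \<le> M" "card E \<ge> \<epsilon> * M\<^sup>2"
    and pos: "\<epsilon> > 0" "M > 0"
  shows "\<exists>A'\<subseteq>A. card A' \<ge> \<epsilon> * M / 2 \<and> card (A' + uminus ` A') \<le> 8192 / \<epsilon> ^ 6 * card A'"
proof -
  define codeg where "codeg a a' = {b. (a, b) \<in> E \<and> (a', b) \<in> E}" for a a'
  define \<kappa> where "\<kappa> = \<epsilon>\<^sup>2 / 32"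
  obtain b0 where b0: "\<epsilon>\<^sup>2 * M\<^sup>2 / 2 + 16 * card {(a, a'). (a, b0) \<in> E \<and> (a', b0) \<in> E \<and> card (codeg a a') < \<kappa> * M}
    \<le> (card {a. (a, b0) \<in> E})\<^sup>2"
    using dense_neighbourhood[OF fin(1,2) E card(1,2,4) pos] by (auto simp: codeg_def \<kappa>_def)
  define P where "P = {a. (a, b0) \<in> E}"
  define m where "m = real (card P)"
  define bd where "bd a = {a'\<in>P. card (codeg a a') < \<kappa> * M}" for a
  define A' where "A' = {a\<in>P. card (bd a) \<le> m / 4}"
  have PA: "P \<subseteq> A" using E by (auto simp: P_def)
  have finP: "finite P" using PA fin finite_subset by auto
  have finbd: "finite (bd a)" for a using finP by (simp add: bd_def)
  have A'P: "A' \<subseteq> P" by (auto simp: A'_def)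
  have fincd: "finite (codeg a a')" for a a'
    using E fin(2) by (auto simp: codeg_def intro: finite_subset[of _ B])
  have "{(a, a'). (a, b0) \<in> E \<and> (a', b0) \<in> E \<and> card (codeg a a') < \<kappa> * M} = Sigma P bd"
    by (auto simp: P_def bd_def)
  then have main: "\<epsilon>\<^sup>2 * M\<^sup>2 / 2 + 16 * (\<Sum>a\<in>P. real (card (bd a))) \<le> m\<^sup>2"
    using b0 finP finbd by (simp add: m_def P_def[symmetric])
  have bdnn: "(\<Sum>a\<in>P. real (card (bd a))) \<ge> 0" by (intro sum_nonneg) auto
  have m2: "\<epsilon>\<^sup>2 * M\<^sup>2 / 2 \<le> m\<^sup>2" using main bdnn by linarith
  have "\<epsilon>\<^sup>2 * M\<^sup>2 > 0" using pos by simp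
  then have "m\<^sup>2 > 0" using m2 by linarith
  then have m0: "m > 0" by (auto simp: m_def)
  \<comment> \<open>Markov: vertices outside \<open>A'\<close> have more than \<open>m / 4\<close>
    bad partners each, while there are at most \<open>m\<^sup>2 / 16\<close> bad pairs.\<close>
  have "card (P - A') * (m / 4) = (\<Sum>a\<in>P - A'. m / 4)" by simp
  also have "\<dots> \<le> (\<Sum>a\<in>P - A'. real (card (bd a)))" by (intro sum_mono) (auto simp: A'_def)
  also have "\<dots> \<le> (\<Sum>a\<in>P. real (card (bd a)))" using finP by (intro sum_mono2) auto
  also have "\<dots> \<le> m\<^sup>2 / 16" using main \<open>\<epsilon>\<^sup>2 * M\<^sup>2 > 0\<close> by linarith
  also have "\<dots> = (m / 4) * (m / 4)" by (simp add: power2_eq_square)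
  finally have "card (P - A') \<le> m / 4" using m0 by simp
  moreover have "real (card (P - A')) = m - card A'"
    using finP A'P finite_subset[OF A'P finP] card_mono[OF finP A'P]
    by (simp add: m_def card_Diff_subset of_nat_diff)
  ultimately have cA': "card A' \<ge> 3 / 4 * m" by linarith
  have "(\<epsilon> * M / 2)\<^sup>2 = \<epsilon>\<^sup>2 * M\<^sup>2 / 4" "(3 / 4 * m)\<^sup>2 = 9 / 16 * m\<^sup>2"
    by (simp_all add: power_mult_distrib power_divide)
  then have "(\<epsilon> * M / 2)\<^sup>2 \<le> (3 / 4 * m)\<^sup>2" using m2 \<open>\<epsilon>\<^sup>2 * M\<^sup>2 > 0\<close> by linarith
  then have "\<epsilon> * M / 2 \<le> 3 / 4 * m" by (rule power2_le_imp_le) (use m0 in simp)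
  then have big: "\<epsilon> * M / 2 \<le> card A'" using cA' by linarith
  define R where "R d = {(c1, c2, c3, c4) \<in> C \<times> C \<times> C \<times> C. c1 - c2 - c3 + c4 = d}" for d
  have finC: "finite (C \<times> C \<times> C \<times> C)" using fin by auto
  have finR: "finite (R d)" for d by (rule finite_subset[OF _ finC]) (auto simp: R_def)
  have reps: "m / 2 * (\<kappa> * M)\<^sup>2 \<le> card (R d)" if d: "d \<in> A' + uminus ` A'" for d
  proof -
    obtain a a' where a: "a \<in> A'" "a' \<in> A'" "d = a - a'"
      using d by (auto elim!: set_plus_elim)
    \<comment> \<open>The possible midpoints \<open>u\<close>; discarding two sets of size at most
      \<open>m / 4\<close> leaves at least \<open>m / 2\<close>.\<close>
    define G where "G = P - (bd a \<union> bd a')"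
    define S where "S = (SIGMA u:G. codeg a u \<times> codeg a' u)"
    have finG: "finite G" using finP by (simp add: G_def)
    have "real (card P) \<le> card (G \<union> (bd a \<union> bd a'))"
      using finG finbd by (intro of_nat_mono card_mono) (auto simp: G_def)
    also have "\<dots> \<le> card G + (card (bd a) + card (bd a'))"
      by (meson card_Un_le add_left_mono le_trans of_nat_mono)
    finally have "m / 2 \<le> card G" using a by (simp add: m_def A'_def)
    then have "m / 2 * (\<kappa> * M)\<^sup>2 \<le> card G * (\<kappa> * M)\<^sup>2" by (intro mult_right_mono) auto
    also have "\<dots> = (\<Sum>u\<in>G. (\<kappa> * M) * (\<kappa> * M))" by (simp add: power2_eq_square)
    also have "\<dots> \<le> (\<Sum>u\<in>G. real (card (codeg a u)) * real (card (codeg a' u)))"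
      using pos by (intro sum_mono mult_mono) (auto simp: G_def bd_def \<kappa>_def)
    also have "\<dots> = card S"
      using finG fincd by (simp add: S_def card_cartesian_product)
    also have "card S \<le> card (R d)"
    proof (rule card_inj_on_le[OF _ _ finR])
      \<comment> \<open>With \<open>a\<close> and \<open>a'\<close> fixed, the first entry
        determines \<open>b\<close>, the second then \<open>u\<close>, and the third
        \<open>b'\<close>.\<close>
      let ?\<phi> = "\<lambda>(u, b, b'). (a + b, u + b, a' + b', u + b')"
      show "inj_on ?\<phi> S" by (auto simp: inj_on_def)
      show "?\<phi> ` S \<subseteq> R d"
        using a by (auto simp: S_def R_def codeg_def sum)
    qed
    finally show ?thesis by simp
  qed
  define D where "D = A' + uminus ` A'"
  have finD: "finite D" unfolding D_def
    using A'P finP finite_subset by (intro finite_set_plus finite_imageI) auto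
  have "card D * (m / 2 * (\<kappa> * M)\<^sup>2) = (\<Sum>d\<in>D. m / 2 * (\<kappa> * M)\<^sup>2)" by simp
  also have "\<dots> \<le> (\<Sum>d\<in>D. real (card (R d)))" using reps by (intro sum_mono) (auto simp: D_def)
  also have "\<dots> = card (\<Union>d\<in>D. R d)"
    using finD finR by (subst card_UN_disjoint) (auto simp: R_def)
  also have "\<dots> \<le> card (C \<times> C \<times> C \<times> C)"
    using finC by (intro of_nat_mono card_mono) (auto simp: R_def)
  also have "\<dots> = real (card C) ^ 4" by (simp add: card_cartesian_product power4_eq_xxxx)
  also have "\<dots> \<le> M ^ 4" using card(3) by (intro power_mono) auto
  finally have "card D * (m / 2 * (\<kappa> * M)\<^sup>2) \<le> M ^ 4" .
  then have "(card D * m * \<epsilon> ^ 4) * M\<^sup>2 \<le> (2048 * M\<^sup>2) * M\<^sup>2"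
    by (simp add: \<kappa>_def power_mult_distrib power_divide power4_eq_xxxx power2_eq_square algebra_simps)
  then have "card D * m * \<epsilon> ^ 4 \<le> 2048 * M\<^sup>2" using pos by simp
  \<comment> \<open>The extra factor \<open>\<epsilon>\<^sup>2\<close> lets \<open>m2\<close> trade
    \<open>M\<^sup>2\<close> for \<open>m\<^sup>2\<close>; this is how the exponent 6
    arises.\<close>
  then have "card D * m * \<epsilon> ^ 4 * \<epsilon>\<^sup>2 \<le> 2048 * M\<^sup>2 * \<epsilon>\<^sup>2" by (intro mult_right_mono) auto
  also have "\<dots> \<le> 4096 * m\<^sup>2" using m2 by (simp add: mult.commute)
  finally have "(card D * \<epsilon> ^ 6) * m \<le> (4096 * m) * m"
    by (simp add: power2_eq_square eval_nat_numeral algebra_simps)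
  then have "card D * \<epsilon> ^ 6 \<le> 4096 * m" using m0 by simp
  also have "\<dots> \<le> 8192 * card A'" using cA' m0 by linarith
  finally have "card D \<le> 8192 / \<epsilon> ^ 6 * card A'"
    using pos by (simp add: field_simps)
  then show ?thesis using big A'P PA unfolding D_def by blast
qed

section \<open>Homomorphisms into the circle\<close>

\<comment> \<open>The group R/Z contains every cyclic group Z_m as the classes of
  \<open>j / m\<close>, so solutions modulo \<open>q\<close> and modulo \<open>q N\<close> live in
  one group; its divisibility allows homomorphisms to be extended and divided by
  \<open>q\<close>.\<close>
quotient_type circle = real / "\<lambda>x y. x - y \<in> \<int>"
proof (rule equivpI)
  show "reflp (\<lambda>x y::real. x - y \<in> \<int>)" by (auto simp: reflp_def)
  show "symp (\<lambda>x y::real. x - y \<in> \<int>)"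
    unfolding symp_def by (metis Ints_minus minus_diff_eq)
  show "transp (\<lambda>x y::real. x - y \<in> \<int>)"
    unfolding transp_def by (metis Ints_add diff_add_cancel add_diff_eq)
qed

instantiation circle :: ab_group_add
begin

lift_definition zero_circle :: circle is 0 .

lift_definition plus_circle :: "circle \<Rightarrow> circle \<Rightarrow> circle" is "(+)"
  by (metis Ints_add add_diff_add)

lift_definition uminus_circle :: "circle \<Rightarrow> circle" is uminus
  by (metis Ints_minus minus_diff_minus)

definition minus_circle :: "circle \<Rightarrow> circle \<Rightarrow> circle" where
  "minus_circle x y = x + - y"

instance
  by (standard; (unfold minus_circle_def)?; transfer) (auto simp: algebra_simps)

end

lift_definition circ :: "real \<Rightarrow> circle" is "\<lambda>r. r" .

lemma circ_add: "circ (r + s) = circ r + circ s"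
  by transfer simp

lemma circ_eq_0_iff: "circ r = 0 \<longleftrightarrow> r \<in> \<int>"
  by transfer simp

lemma circ_minus: "circ (- r) = - circ r"
  by transfer simp

lemma circ_diff: "circ (r - s) = circ r - circ s"
  using circ_add[of r "- s"] by (simp add: circ_minus)

lemma circ_surj: "\<exists>r. s = circ r"
  by transfer (metis Ints_0 diff_self)

lemma nmul_circ: "nmul n (circ r) = circ (real n * r)"
proof (induction n)
  case 0
  then show ?case by (simp add: circ_eq_0_iff[THEN iffD2])
next
  case (Suc n)
  then show ?case by (simp add: algebra_simps flip: circ_add)
qed

lemma circle_divisible: "n > 0 \<Longrightarrow> \<exists>s. nmul n s = (r :: circle)"
  by (metis circ_surj nmul_circ nonzero_mult_div_cancel_left of_nat_0_less_iff order_less_irrefl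
      times_divide_eq_right)

lemma circle_torsion:
  assumes "n > 0" "nmul n s = (0 :: circle)"
  shows "\<exists>j. s = circ (of_int j / real n)"
proof -
  obtain r where r: "s = circ r" using circ_surj by blast
  then have "real n * r \<in> \<int>" using assms by (simp add: nmul_circ circ_eq_0_iff)
  then obtain j where "real n * r = of_int j" by (auto elim: Ints_cases)
  then have "r = of_int j / real n" using assms(1) by (simp add: field_simps)
  then show ?thesis using r by blast
qed

text \<open>With \<open>circle_torsion\<close> this identifies Z_n with the n-torsion of the circle,
  which translates congruences into equations and back.\<close>

lemma circ_div_eq_iff:
  assumes "n > 0"
  shows "circ (of_int i / real n) = circ (of_int j / real n) \<longleftrightarrow> [i = j] (mod int n)"
proof -
  have "circ (of_int i / real n) = circ (of_int j / real n) \<longleftrightarrow> of_int (i - j) / real n \<in> \<int>"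
    using circ_eq_0_iff[of "of_int i / real n - of_int j / real n"]
    by (simp add: circ_diff diff_divide_distrib)
  also have "\<dots> \<longleftrightarrow> int n dvd i - j"
  proof
    assume "of_int (i - j) / real n \<in> \<int>"
    then obtain l where "of_int (i - j) / real n = of_int l" by (auto elim: Ints_cases)
    then have "real_of_int (i - j) = of_int (l * int n)" using assms by (simp add: field_simps)
    then have "i - j = l * int n" by (simp only: of_int_eq_iff)
    then show "int n dvd i - j" by simp
  next
    assume "int n dvd i - j"
    then obtain l where "i - j = int n * l" by (auto elim: dvdE)
    then have "of_int (i - j) / real n = of_int l" using assms by simp
    then show "of_int (i - j) / real n \<in> \<int>" by simp
  qed
  finally show ?thesis by (simp add: cong_iff_dvd_diff)
qed

section \<open>Extending homomorphisms from a subgroup to the whole group\<close>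

definition additive_subgroup :: "'b::ab_group_add set \<Rightarrow> bool" where
  "additive_subgroup G \<longleftrightarrow> 0 \<in> G \<and> (\<forall>x\<in>G. \<forall>y\<in>G. x - y \<in> G)"

lemma additive_subgroupD:
  assumes "additive_subgroup G"
  shows "0 \<in> G" "x \<in> G \<Longrightarrow> y \<in> G \<Longrightarrow> x - y \<in> G" "x \<in> G \<Longrightarrow> - x \<in> G"
    "x \<in> G \<Longrightarrow> y \<in> G \<Longrightarrow> x + y \<in> G" "x \<in> G \<Longrightarrow> nmul n x \<in> G"
proof -
  show z: "0 \<in> G" and d: "\<And>x y. x \<in> G \<Longrightarrow> y \<in> G \<Longrightarrow> x - y \<in> G"
    using assms by (auto simp: additive_subgroup_def)
  show m: "\<And>x. x \<in> G \<Longrightarrow> - x \<in> G" using d[OF z] by simp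
  show a: "\<And>x y. x \<in> G \<Longrightarrow> y \<in> G \<Longrightarrow> x + y \<in> G" using d m by fastforce
  show "x \<in> G \<Longrightarrow> nmul n x \<in> G" by (induction n) (auto intro: z a)
qed

text \<open>A partial homomorphism into the circle is encoded by its graph, a subgroup of the product
  that meets \<open>{0} \<times> circle\<close> trivially.\<close>

lemma extend_hom_graph:
  fixes G :: "('a::{ab_group_add, finite} \<times> circle) set"
  assumes G: "additive_subgroup G" and single: "\<And>s. (0, s) \<in> G \<Longrightarrow> s = 0" and x: "x \<notin> fst ` G"
  shows "\<exists>G'. additive_subgroup G' \<and> (\<forall>s. (0, s) \<in> G' \<longrightarrow> s = 0) \<and> G \<subseteq> G' \<and> x \<in> fst ` G'"
proof -
  note G' = additive_subgroupD[OF G]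
  define r where "r = (LEAST r. r > 0 \<and> nmul r x \<in> fst ` G)"
  obtain r0 where "r0 > 0" "nmul r0 x = 0" using nmul_eq_0_in_finite_group by blast
  then have "r0 > 0 \<and> nmul r0 x \<in> fst ` G" using G'(1) by (force simp: zero_prod_def)
  then have "r > 0 \<and> nmul r x \<in> fst ` G" unfolding r_def by (rule LeastI)
  then obtain u where r: "r > 0" "(nmul r x, u) \<in> G" by auto
  have least: "r \<le> j" if "j > 0" "(nmul j x, w) \<in> G" for j w
    unfolding r_def using that by (intro Least_le) force
  \<comment> \<open>Divisibility supplies a value at \<open>x\<close> compatible with the value
    \<open>u\<close> already prescribed at \<open>r x\<close>.\<close>
  obtain v where v: "nmul r v = u" using circle_divisible[OF r(1)] by blast
  define e where "e = (x, v)"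
  have re: "nmul r e \<in> G" using r v by (simp add: e_def nmul_Pair)
  \<comment> \<open>By minimality of \<open>r\<close>, every multiple of \<open>x\<close> in the old
    domain is a multiple of \<open>r x\<close>; so adjoining \<open>e\<close> creates no second
    value there.\<close>
  have e_mult: "nmul j e \<in> G" if "(nmul j x, w) \<in> G" for j w
  proof -
    have "(nmul j x, w) - nmul (j div r) (nmul r x, u) \<in> G"
      using that r(2) by (intro G'(2) G'(5))
    then have "(nmul (j mod r) x, w - nmul (j div r) u) \<in> G"
      using nmul_div_mod[of j x r] by (simp add: nmul_Pair)
    then have "j mod r = 0" using least[of "j mod r"] mod_less_divisor[OF r(1), of j] by fastforce
    then show ?thesis using nmul_div_mod[of j e r] G'(5)[OF re] by simp
  qed
  \<comment> \<open>Two natural coefficients stand for the integer \<open>i - j\<close>, since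
    \<open>nmul\<close> takes natural multiples only.\<close>
  define G1 where "G1 = {g + nmul i e - nmul j e | g i j. g \<in> G}"
  have G1I: "g \<in> G \<Longrightarrow> h = g + nmul i e - nmul j e \<Longrightarrow> h \<in> G1" for g i j h
    unfolding G1_def by blast
  have "additive_subgroup G1"
    unfolding additive_subgroup_def
  proof (intro conjI ballI)
    show "0 \<in> G1" using G1I[OF G'(1), of _ 0 0] by simp
    fix y z assume "y \<in> G1" "z \<in> G1"
    then obtain g i j g' i' j' where gg: "g \<in> G" "g' \<in> G"
      "y = g + nmul i e - nmul j e" "z = g' + nmul i' e - nmul j' e" unfolding G1_def by blast
    have "y - z = (g - g') + nmul (i + j') e - nmul (j + i') e"
      unfolding gg(3,4) by (simp add: nmul_add_left algebra_simps)
    then show "y - z \<in> G1" using G1I G'(2)[OF gg(1,2)] by blast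
  qed
  moreover have "s = 0" if s: "(0, s) \<in> G1" for s
  proof -
    obtain g i j where g: "g \<in> G" "(0, s) = g + nmul i e - nmul j e" using s unfolding G1_def by blast
    \<comment> \<open>Kept general in \<open>g'\<close> to cover both signs of \<open>i - j\<close>;
      the second case applies it to \<open>- g\<close>.\<close>
    have mult_G: "nmul (i' - j') e \<in> G" if ij: "j' \<le> i'" and
      g': "g' \<in> G" "fst g' + nmul i' x - nmul j' x = 0" for g' and i' j' :: nat
    proof -
      have "nmul i' x = nmul (i' - j') x + nmul j' x" using ij by (simp flip: nmul_add_left)
      then have "nmul (i' - j') x = - fst g'" using g'(2) by (simp add: algebra_simps eq_neg_iff_add_eq_0)
      then have "(nmul (i' - j') x, - snd g') = - g'" by (simp add: prod_eq_iff)
      then show ?thesis using G'(3)[OF g'(1)] e_mult by metis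
    qed
    have fst: "fst g + nmul i x - nmul j x = 0"
      using arg_cong[OF g(2), of fst] by (simp add: e_def nmul_Pair)
    have "(0, s) \<in> G"
    proof (cases "j \<le> i")
      case True
      have "nmul i e = nmul (i - j) e + nmul j e" using True by (simp flip: nmul_add_left)
      then have "(0, s) = g + nmul (i - j) e" using g(2) by simp
      then show ?thesis using mult_G[OF True g(1) fst] G'(4)[OF g(1)] by metis
    next
      case False
      then have ij: "i \<le> j" by simp
      have "nmul j e = nmul (j - i) e + nmul i e" using ij by (simp flip: nmul_add_left)
      then have "(0, s) = g - nmul (j - i) e" using g(2) by simp
      moreover have "fst (- g) + nmul j x - nmul i x = 0" using fst by (simp add: algebra_simps)
      then have "nmul (j - i) e \<in> G" using mult_G[OF ij G'(3)[OF g(1)]] by blast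
      ultimately show ?thesis using G'(2)[OF g(1)] by metis
    qed
    then show ?thesis by (rule single)
  qed
  moreover have "G \<subseteq> G1" using G1I[of _ _ 0 0] by auto
  moreover have "e \<in> G1" using G1I[OF G'(1), of e 1 0] by simp
  then have "x \<in> fst ` G1" by (force simp: e_def)
  ultimately show ?thesis by blast
qed

text \<open>Domains are subsets of a finite group, so some single-valued subgroup containing
  \<open>G\<close> has a largest domain; \<open>extend_hom_graph\<close> would enlarge any domain
  short of the whole group.\<close>

lemma extend_hom:
  fixes G :: "('a::{ab_group_add, finite} \<times> circle) set"
  assumes "additive_subgroup G" and "\<And>s. (0, s) \<in> G \<Longrightarrow> s = 0"
  shows "\<exists>\<gamma>. (\<forall>x y. \<gamma> (x + y) = \<gamma> x + \<gamma> y) \<and> (\<forall>(x, s)\<in>G. \<gamma> x = s)"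
proof -
  define P where "P G' \<longleftrightarrow> additive_subgroup G' \<and> (\<forall>s. (0, s) \<in> G' \<longrightarrow> s = 0) \<and> G \<subseteq> G'" for G' :: "('a \<times> circle) set"
  have "P G" using assms by (auto simp: P_def)
  moreover have "\<forall>G'. P G' \<longrightarrow> card (fst ` G') < Suc (card (UNIV :: 'a set))"
    by (auto simp: less_Suc_eq_le intro: card_mono)
  ultimately obtain H where H: "P H" "\<And>G'. P G' \<Longrightarrow> card (fst ` G') \<le> card (fst ` H)"
    using ex_has_greatest_nat[of P G "\<lambda>G'. card (fst ` G')" "Suc (card (UNIV :: 'a set))"] by blast
  then have sub: "additive_subgroup H" and single: "\<And>s. (0, s) \<in> H \<Longrightarrow> s = 0" by (auto simp: P_def)
  note H' = additive_subgroupD[OF sub]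
  have "x \<in> fst ` H" for x
  proof (rule ccontr)
    assume x: "x \<notin> fst ` H"
    then obtain H1 where H1: "additive_subgroup H1" "\<forall>s. (0, s) \<in> H1 \<longrightarrow> s = 0" "H \<subseteq> H1" "x \<in> fst ` H1"
      using extend_hom_graph[OF sub single x] by blast
    then have "P H1" using H(1) by (auto simp: P_def)
    moreover have "fst ` H \<subset> fst ` H1" using H1(3,4) x by blast
    then have "card (fst ` H) < card (fst ` H1)" by (intro psubset_card_mono) auto
    ultimately show False using H(2) by force
  qed
  then have "\<forall>x. \<exists>s. (x, s) \<in> H" by force
  then obtain \<gamma> where \<gamma>: "\<And>x. (x, \<gamma> x) \<in> H" by metis
  have uniq: "s = s'" if "(x, s) \<in> H" "(x, s') \<in> H" for x s s'
    using H'(2)[OF that] single[of "s - s'"] by simp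
  have "\<gamma> (x + y) = \<gamma> x + \<gamma> y" for x y
    using uniq[OF \<gamma>, of "x + y" "\<gamma> x + \<gamma> y"] H'(4)[OF \<gamma> \<gamma>, of x y] by simp
  moreover have "\<gamma> x = s" if "(x, s) \<in> G" for x s
    using that H(1) uniq[OF \<gamma>] by (auto simp: P_def)
  ultimately show ?thesis by (intro exI[of _ \<gamma>]) auto
qed

text \<open>The map sending \<open>q x\<close> to \<open>\<alpha> x\<close> is well defined because
  \<open>\<alpha>\<close> vanishes on the q-torsion. Any extension \<open>\<gamma>\<close> of it to
  the whole group satisfies \<open>\<alpha> x = \<gamma> (q x) = q (\<gamma> x)\<close>.\<close>

lemma hom_divisible:
  fixes \<alpha> :: "'a::{ab_group_add, finite} \<Rightarrow> circle"
  assumes hom: "\<And>x y. \<alpha> (x + y) = \<alpha> x + \<alpha> y" and vanish: "\<And>x. nmul q x = 0 \<Longrightarrow> \<alpha> x = 0"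
  shows "\<exists>\<gamma>. (\<forall>x y. \<gamma> (x + y) = \<gamma> x + \<gamma> y) \<and> (\<forall>x. \<alpha> x = nmul q (\<gamma> x))"
proof -
  have \<alpha>0: "\<alpha> 0 = 0" using hom[of 0 0] by simp
  have \<alpha>d: "\<alpha> (x - y) = \<alpha> x - \<alpha> y" for x y using hom[of "x - y" y] by simp
  define G where "G = range (\<lambda>x. (nmul q x, \<alpha> x))"
  have "additive_subgroup G"
    unfolding additive_subgroup_def
  proof (intro conjI ballI)
    show "0 \<in> G" unfolding G_def by (rule image_eqI[of _ _ 0]) (simp_all add: \<alpha>0 zero_prod_def)
    fix y z assume "y \<in> G" "z \<in> G"
    then obtain u v where "y = (nmul q u, \<alpha> u)" "z = (nmul q v, \<alpha> v)" by (auto simp: G_def)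
    then have "y - z = (nmul q (u - v), \<alpha> (u - v))" by (simp add: \<alpha>d nmul_diff)
    then show "y - z \<in> G" unfolding G_def by (rule range_eqI)
  qed
  moreover have "s = 0" if "(0, s) \<in> G" for s using that vanish by (auto simp: G_def)
  ultimately obtain \<gamma> where \<gamma>: "\<forall>x y. \<gamma> (x + y) = \<gamma> x + \<gamma> y" "\<forall>(x, s)\<in>G. \<gamma> x = s"
    using extend_hom by blast
  have "\<gamma> 0 = 0" using \<gamma>(1)[rule_format, of 0 0] by simp
  then have "\<gamma> (nmul n x) = nmul n (\<gamma> x)" for n x
    using \<gamma>(1) by (induction n) auto
  then have "\<alpha> x = nmul q (\<gamma> x)" for x using \<gamma>(2) by (force simp: G_def)
  then show ?thesis using \<gamma>(1) by blast
qed

text \<open>Multiplication by \<open>q\<close> kills the right-hand side, so \<open>q a\<close> and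
  \<open>q b\<close> agree up to constants with one homomorphism \<open>\<alpha>\<close>. If
  \<open>\<alpha>\<close> were \<open>q \<gamma>\<close>, subtracting \<open>\<gamma>\<close> would
  move \<open>a\<close>, \<open>b\<close>, \<open>c\<close>, up to constants, into the q-torsion and
  give a solution modulo \<open>q\<close>.\<close>

lemma torsion_obstruction:
  fixes a b c :: "'a::{ab_group_add, finite} \<Rightarrow> circle" and t :: "'a \<Rightarrow> 'a \<Rightarrow> 'a \<Rightarrow> int"
  assumes q: "q > 0"
    and sol: "\<And>x y z. x + y + z = 0 \<Longrightarrow> a x + b y + c z = circ (of_int (t x y z) / real q)"
    and nosol: "\<not> (\<exists>a b c :: 'a \<Rightarrow> int. \<forall>x y z. x + y + z = 0 \<longrightarrow> [a x + b y + c z = t x y z] (mod int q))"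
  shows "\<exists>\<alpha> u x0. (\<forall>x y. \<alpha> (x + y) = \<alpha> x + \<alpha> y) \<and> (\<forall>x. nmul q (a x) = \<alpha> x + u) \<and>
    nmul q x0 = 0 \<and> \<alpha> x0 \<noteq> 0"
proof -
  define \<alpha> where "\<alpha> x = nmul q (a x) - nmul q (a 0)" for x
  have zero: "nmul q (circ (of_int j / real q)) = 0" for j
    using q by (simp add: nmul_circ circ_eq_0_iff)
  have qsol: "nmul q (a x) + nmul q (b y) + nmul q (c z) = 0" if "x + y + z = 0" for x y z
    unfolding nmul_add_right[symmetric] sol[OF that] by (rule zero)
  \<comment> \<open>Both zero-sum triples used contain the same value of \<open>c\<close>, which
    cancels.\<close>
  have ab: "nmul q (a x) + nmul q (b y) = nmul q (a (x + y)) + nmul q (b 0)" for x y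
    using qsol[of x y "- (x + y)"] qsol[of "x + y" 0 "- (x + y)"]
    by (metis add_right_cancel add.right_neutral right_minus)
  have \<alpha>b: "\<alpha> y = nmul q (b y) - nmul q (b 0)" for y
    using ab[of 0 y] by (simp add: \<alpha>_def algebra_simps)
  have hom: "\<alpha> (x + y) = \<alpha> x + \<alpha> y" for x y
  proof -
    have "\<alpha> x + \<alpha> y = (nmul q (a x) + nmul q (b y)) - nmul q (a 0) - nmul q (b 0)"
      unfolding \<alpha>b[of y] by (simp add: \<alpha>_def)
    also have "\<dots> = \<alpha> (x + y)" unfolding ab[of x y] by (simp add: \<alpha>_def)
    finally show ?thesis by simp
  qed
  have "\<exists>x0. nmul q x0 = 0 \<and> \<alpha> x0 \<noteq> 0"
  proof (rule ccontr)
    assume "\<not> ?thesis"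
    then have "\<exists>\<gamma>. (\<forall>x y. \<gamma> (x + y) = \<gamma> x + \<gamma> y) \<and> (\<forall>x. \<alpha> x = nmul q (\<gamma> x))"
      using hom by (intro hom_divisible) blast+
    then obtain \<gamma> where \<gamma>: "\<And>x y. \<gamma> (x + y) = \<gamma> x + \<gamma> y" "\<And>x. nmul q (\<gamma> x) = \<alpha> x" by metis
    obtain u v where uv: "nmul q u = nmul q (a 0)" "nmul q v = nmul q (b 0)" by blast
    \<comment> \<open>The equation survives: \<open>\<gamma>\<close> sums to 0 on zero-sum triples,
      and the added constants \<open>- u\<close>, \<open>- v\<close>, \<open>u + v\<close>
      cancel.\<close>
    define a' where "a' x = a x - \<gamma> x - u" for x
    define b' where "b' x = b x - \<gamma> x - v" for x
    define c' where "c' x = c x - \<gamma> x + (u + v)" for x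
    have sol': "a' x + b' y + c' z = circ (of_int (t x y z) / real q)" if "x + y + z = 0" for x y z
    proof -
      have "\<gamma> x + \<gamma> y + \<gamma> z = 0" using \<gamma>(1) that by (metis add_cancel_right_left)
      moreover have "a' x + b' y + c' z = (a x + b y + c z) - (\<gamma> x + \<gamma> y + \<gamma> z)"
        by (simp add: a'_def b'_def c'_def)
      ultimately show ?thesis using sol[OF that] by simp
    qed
    have qa: "nmul q (a' x) = 0" for x by (simp add: a'_def nmul_diff \<gamma>(2) uv \<alpha>_def)
    have qb: "nmul q (b' x) = 0" for x by (simp add: b'_def nmul_diff \<gamma>(2) uv \<alpha>b)
    \<comment> \<open>For \<open>c'\<close> torsion follows from the equation at
      \<open>(- x, 0, x)\<close>, where \<open>q\<close> kills every other term.\<close>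
    have qc: "nmul q (c' x) = 0" for x
    proof -
      have "nmul q (a' (- x) + b' 0 + c' x) = 0" using sol'[of "- x" 0 x] zero by simp
      then show ?thesis by (simp add: nmul_add_right qa qb)
    qed
    obtain A where A: "\<And>x. a' x = circ (of_int (A x) / real q)" using circle_torsion[OF q qa] by metis
    obtain B where B: "\<And>x. b' x = circ (of_int (B x) / real q)" using circle_torsion[OF q qb] by metis
    obtain C where C: "\<And>x. c' x = circ (of_int (C x) / real q)" using circle_torsion[OF q qc] by metis
    have "[A x + B y + C z = t x y z] (mod int q)" if "x + y + z = 0" for x y z
      using sol'[OF that] unfolding A B C circ_div_eq_iff[OF q, symmetric]
      by (simp add: add_divide_distrib circ_add)
    then show False using nosol by blast
  qed
  then obtain x0 where "nmul q x0 = 0" "\<alpha> x0 \<noteq> 0" by blast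
  moreover have "nmul q (a x) = \<alpha> x + nmul q (a 0)" for x by (simp add: \<alpha>_def)
  ultimately show ?thesis using hom by blast
qed

section \<open>Fibres of multiplication by q and the joint kernel with alpha\<close>

lemma card_joint_fibre_le:
  fixes \<alpha> :: "'a::{ab_group_add, finite} \<Rightarrow> circle"
  assumes hom: "\<And>x y. \<alpha> (x + y) = \<alpha> x + \<alpha> y"
  shows "card {x. nmul q x = w \<and> \<alpha> x = v} \<le> card {x. nmul q x = 0 \<and> \<alpha> x = 0}"
proof (cases "{x. nmul q x = w \<and> \<alpha> x = v} = {}")
  case True
  then show ?thesis by (simp only: card.empty le0)
next
  case False
  then obtain x0 where x0: "nmul q x0 = w" "\<alpha> x0 = v" by auto
  have \<alpha>d: "\<alpha> (x - y) = \<alpha> x - \<alpha> y" for x y using hom[of "x - y" y] by simp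
  show ?thesis
    by (rule card_inj_on_le[of "\<lambda>x. x - x0"]) (auto simp: inj_on_def nmul_diff \<alpha>d x0)
qed

text \<open>Fibres over the range are translates of the q-torsion, so range times torsion counts the
  whole group. Since \<open>x0\<close> is torsion but outside the joint kernel, the inequality is
  strict; this gap in each coordinate drives the exponential decay.\<close>

lemma card_image_mult_joint_kernel:
  fixes \<alpha> :: "'a::{ab_group_add, finite} \<Rightarrow> circle"
  assumes "nmul q x0 = 0" "\<alpha> x0 \<noteq> 0"
  shows "card (range (nmul q :: 'a \<Rightarrow> 'a)) * card {x. nmul q x = 0 \<and> \<alpha> x = 0} < card (UNIV :: 'a set)"
proof -
  let ?T = "{x::'a. nmul q x = 0}"
  have fib: "card {x::'a. nmul q x = w} = card ?T" if w: "w \<in> range (nmul q)" for w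
  proof -
    obtain y where y: "w = nmul q y" using w by auto
    have "bij_betw (\<lambda>x. x - y) {x. nmul q x = w} ?T"
      by (rule bij_betwI[of _ _ _ "\<lambda>x. x + y"]) (auto simp: nmul_diff nmul_add_right y)
    then show ?thesis by (rule bij_betw_same_card)
  qed
  have "card (range (nmul q :: 'a \<Rightarrow> 'a)) * card {x. nmul q x = 0 \<and> \<alpha> x = 0}
    < card (range (nmul q :: 'a \<Rightarrow> 'a)) * card ?T"
    using assms by (intro mult_strict_left_mono psubset_card_mono) (auto simp: card_gt_0_iff)
  also have "\<dots> = (\<Sum>w\<in>range (nmul q). card {x::'a. nmul q x = w})" using fib by simp
  also have "\<dots> = card (\<Union>w\<in>range (nmul q). {x::'a. nmul q x = w})"
    by (rule card_UN_disjoint[symmetric]) auto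
  also have "(\<Union>w\<in>range (nmul q). {x::'a. nmul q x = w}) = UNIV" by auto
  finally show ?thesis .
qed

section \<open>Counting successful triples\<close>

lemma finite_vecs: "finite (vecs n :: (nat \<Rightarrow> 'a::finite) set)"
  by (simp add: vecs_def finite_PiE)

lemma card_vecs: "card (vecs n :: (nat \<Rightarrow> 'a::finite) set) = card (UNIV :: 'a set) ^ n"
  by (simp add: vecs_def card_PiE)

lemma restrict_in_vecs: "(\<lambda>i\<in>{..<n}. x i) \<in> vecs n"
  by (simp add: vecs_def)

lemma vecs_eqI: "x \<in> vecs n \<Longrightarrow> y \<in> vecs n \<Longrightarrow> (\<And>i. i < n \<Longrightarrow> x i = y i) \<Longrightarrow> x = y"
  unfolding vecs_def by (rule PiE_ext) auto

text \<open>The value 0 beyond \<open>n\<close>, unlike the undefined values in \<open>vecs\<close>,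
  makes sums and negatives of graph points behave at every index, so the pointwise group of
  functions can be used.\<close>

definition graph_point :: "nat \<Rightarrow> ((nat \<Rightarrow> 'a) \<Rightarrow> nat \<Rightarrow> 'b) \<Rightarrow> (nat \<Rightarrow> 'a) \<Rightarrow> nat \<Rightarrow> 'a::zero \<times> 'b::zero" where
  "graph_point n F x i = (if i < n then (x i, F x i) else 0)"

lemma inj_on_graph_point: "inj_on (graph_point n F) (vecs n)"
proof (rule inj_onI)
  fix x y assume xy: "x \<in> vecs n" "y \<in> vecs n" "graph_point n F x = graph_point n F y"
  show "x = y"
  proof (rule vecs_eqI[OF xy(1,2)])
    fix i assume "i < n"
    then show "x i = y i" using fun_cong[OF xy(3), of i] by (simp add: graph_point_def)
  qed
qed

text \<open>Over a fixed value \<open>w\<close> of \<open>q x\<close>, the dilates of the graph differ only in the circle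
  coordinates, hence translate a subset \<open>X\<close> of the graph to disjoint sets.\<close>

lemma card_fibre_values_le:
  fixes F :: "(nat \<Rightarrow> 'a::{ab_group_add, finite}) \<Rightarrow> nat \<Rightarrow> circle" and \<alpha> :: "'a \<Rightarrow> circle"
  assumes qF: "\<And>x i. i < n \<Longrightarrow> nmul q (F x i) = \<alpha> (x i) + u"
    and X: "X \<subseteq> graph_point n F ` vecs n" and Y: "Y \<subseteq> vecs n" and w: "w \<in> vecs n"
  shows "card X * card ((\<lambda>x. \<lambda>i\<in>{..<n}. \<alpha> (x i)) ` {x\<in>Y. \<forall>i<n. nmul q (x i) = w i})
    \<le> card (X + nmul q (uminus ` graph_point n F ` Y))"
proof -
  define V where "V = (\<lambda>x. \<lambda>i\<in>{..<n}. \<alpha> (x i)) ` {x\<in>Y. \<forall>i<n. nmul q (x i) = w i}"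
  \<comment> \<open>The subtracted vector is the dilate by \<open>q\<close> of a graph point over
    \<open>w\<close> with value vector \<open>v\<close>; by \<open>qF\<close> it depends on nothing
    else.\<close>
  define \<phi> where "\<phi> = (\<lambda>(\<xi>, v). \<xi> - (\<lambda>i. if i < n then (w i, v i + u) else 0))"
  have VP: "V \<subseteq> {..<n} \<rightarrow>\<^sub>E UNIV" unfolding V_def by (intro image_subsetI) simp
  have finY: "finite Y" using Y finite_vecs finite_subset by blast
  have finX: "finite X" using X finite_vecs finite_subset by blast
  have "card (X \<times> V) \<le> card (X + nmul q (uminus ` graph_point n F ` Y))"
  proof (rule card_inj_on_le[of \<phi>])
    show "finite (X + nmul q (uminus ` graph_point n F ` Y))"
      using finX finY by (intro finite_set_plus finite_set_nmul finite_imageI)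
    show "\<phi> ` (X \<times> V) \<subseteq> X + nmul q (uminus ` graph_point n F ` Y)"
    proof
      fix z assume "z \<in> \<phi> ` (X \<times> V)"
      then obtain \<xi> x where x: "\<xi> \<in> X" "x \<in> Y" "\<And>i. i < n \<Longrightarrow> nmul q (x i) = w i"
        "z = \<phi> (\<xi>, \<lambda>i\<in>{..<n}. \<alpha> (x i))"
        by (auto simp: V_def)
      have "(\<lambda>i. if i < n then (w i, (\<lambda>i\<in>{..<n}. \<alpha> (x i)) i + u) else 0) = nmul q (graph_point n F x)"
        using x(3) qF by (auto simp: fun_eq_iff nmul_apply graph_point_def nmul_Pair)
      then have "z = \<xi> + nmul q (- graph_point n F x)"
        unfolding x(4) \<phi>_def by (simp add: nmul_minus)
      then show "z \<in> X + nmul q (uminus ` graph_point n F ` Y)"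
        using x(1,2) by (auto intro!: set_plus_intro nmul_in_set_nmul)
    qed
    show "inj_on \<phi> (X \<times> V)"
    proof (rule inj_onI)
      fix s s' assume "s \<in> X \<times> V" "s' \<in> X \<times> V" and eq: "\<phi> s = \<phi> s'"
      then obtain \<xi> v \<xi>' v' where s: "s = (\<xi>, v)" "s' = (\<xi>', v')" "\<xi> \<in> X" "\<xi>' \<in> X" "v \<in> V" "v' \<in> V"
        by blast
      obtain x x' where x: "\<xi> = graph_point n F x" "\<xi>' = graph_point n F x'" "x \<in> vecs n" "x' \<in> vecs n"
        using X s by blast
      \<comment> \<open>As \<open>w\<close> is common, first coordinates recover \<open>x\<close>;
        then the circle coordinates recover \<open>v\<close>.\<close>
      have pt: "graph_point n F x i - (w i, v i + u) = graph_point n F x' i - (w i, v' i + u)" if "i < n" for i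
        using fun_cong[OF eq, of i] that by (simp add: s x \<phi>_def)
      have "x = x'"
      proof (rule vecs_eqI[OF x(3,4)])
        fix i assume "i < n" then show "x i = x' i" using pt[of i] by (simp add: graph_point_def)
      qed
      moreover have "v = v'"
      proof (rule PiE_ext[of _ "{..<n}" "\<lambda>_. UNIV"])
        show "v \<in> {..<n} \<rightarrow>\<^sub>E UNIV" "v' \<in> {..<n} \<rightarrow>\<^sub>E UNIV" using s(5,6) VP by auto
        fix i assume "i \<in> {..<n}"
        then show "v i = v' i" using pt[of i] \<open>x = x'\<close> by (simp add: graph_point_def)
      qed
      ultimately show "s = s'" by (simp add: s x)
    qed
  qed
  then show ?thesis by (simp add: card_cartesian_product V_def)
qed

text \<open>Sort \<open>Y\<close> by \<open>w = q x\<close> and then by the vector of values of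
  \<open>\<alpha>\<close>: each \<open>w\<close> admits at most \<open>L\<close> vectors, and each
  vector at most \<open>\<kappa> ^ n\<close> points. The strict inequality for the joint kernel
  bounds the number of \<open>w\<close> times \<open>\<kappa> ^ n\<close>.\<close>

lemma card_le_fibre_values:
  fixes \<alpha> :: "'a::{ab_group_add, finite} \<Rightarrow> circle" and L :: real
  assumes hom: "\<And>x y. \<alpha> (x + y) = \<alpha> x + \<alpha> y" and x0: "nmul q x0 = 0" "\<alpha> x0 \<noteq> 0"
    and Y: "Y \<subseteq> vecs n"
    and L: "\<And>w. w \<in> vecs n \<Longrightarrow>
      card ((\<lambda>x. \<lambda>i\<in>{..<n}. \<alpha> (x i)) ` {x\<in>Y. \<forall>i<n. nmul q (x i) = w i}) \<le> L"
  shows "card Y \<le> real (card (UNIV :: 'a set) - 1) ^ n * L"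
proof -
  define \<kappa> where "\<kappa> = card {x. nmul q x = 0 \<and> \<alpha> x = 0}"
  define W where "W = {..<n} \<rightarrow>\<^sub>E range (nmul q :: 'a \<Rightarrow> 'a)"
  define Yw where "Yw w = {x\<in>Y. \<forall>i<n. nmul q (x i) = w i}" for w
  define val where "val x = (\<lambda>i\<in>{..<n}. \<alpha> (x i))" for x :: "nat \<Rightarrow> 'a"
  have finY: "finite Y" using Y finite_vecs finite_subset by blast
  have finW: "finite W" by (simp add: W_def finite_PiE)
  have WV: "W \<subseteq> vecs n" by (auto simp: W_def vecs_def)
  have L0: "L \<ge> 0" using L[of "\<lambda>i\<in>{..<n}. 0"] by (smt (verit) of_nat_0_le_iff vecs_def restrict_PiE_iff UNIV_I)
  have Yw: "card (Yw w) \<le> real (\<kappa> ^ n) * L" if w: "w \<in> W" for w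
  proof -
    have fin: "finite (Yw w)" using finY by (simp add: Yw_def)
    have "card (Yw w) = (\<Sum>v\<in>val ` Yw w. card {x\<in>Yw w. val x = v})"
      using sum.image_gen[OF fin, of "\<lambda>_. 1 :: nat" val] by simp
    also have "\<dots> \<le> (\<Sum>v\<in>val ` Yw w. \<kappa> ^ n)"
    proof (intro sum_mono)
      fix v
      have "{x\<in>Yw w. val x = v} \<subseteq> (PiE {..<n} (\<lambda>i. {y. nmul q y = w i \<and> \<alpha> y = v i}))"
        using Y by (auto simp: Yw_def val_def vecs_def PiE_def)
      then have "card {x\<in>Yw w. val x = v} \<le> card (PiE {..<n} (\<lambda>i. {y. nmul q y = w i \<and> \<alpha> y = v i}))"
        by (intro card_mono finite_PiE) auto
      also have "\<dots> = (\<Prod>i<n. card {y. nmul q y = w i \<and> \<alpha> y = v i})" by (simp add: card_PiE)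
      also have "\<dots> \<le> (\<Prod>i<n. \<kappa>)"
        unfolding \<kappa>_def by (intro prod_mono conjI card_joint_fibre_le hom) auto
      finally show "card {x\<in>Yw w. val x = v} \<le> \<kappa> ^ n" by simp
    qed
    also have "\<dots> = \<kappa> ^ n * card (val ` Yw w)" by simp
    finally have "real (card (Yw w)) \<le> real (\<kappa> ^ n) * real (card (val ` Yw w))"
      by (metis of_nat_mono of_nat_mult)
    also have "\<dots> \<le> real (\<kappa> ^ n) * L"
      using L[of w] w WV by (intro mult_left_mono) (auto simp: Yw_def val_def[abs_def])
    finally show ?thesis .
  qed
  have "Y \<subseteq> (\<Union>w\<in>W. Yw w)"
  proof
    fix x assume "x \<in> Y"
    then show "x \<in> (\<Union>w\<in>W. Yw w)"
      by (intro UN_I[of "\<lambda>i\<in>{..<n}. nmul q (x i)"]) (auto simp: W_def Yw_def)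
  qed
  then have "card Y \<le> card (\<Union>w\<in>W. Yw w)"
    using finW finY by (intro card_mono) (auto simp: Yw_def)
  also have "\<dots> \<le> (\<Sum>w\<in>W. card (Yw w))" using finW by (rule card_UN_le)
  finally have "real (card Y) \<le> (\<Sum>w\<in>W. real (card (Yw w)))" by (simp flip: of_nat_sum)
  also have "\<dots> \<le> (\<Sum>w\<in>W. real (\<kappa> ^ n) * L)" by (intro sum_mono Yw)
  also have "\<dots> = real (card (range (nmul q :: 'a \<Rightarrow> 'a)) * \<kappa>) ^ n * L"
    by (simp add: W_def card_PiE power_mult_distrib)
  also have "\<dots> \<le> real (card (UNIV :: 'a set) - 1) ^ n * L"
    using card_image_mult_joint_kernel[of q x0 \<alpha>] x0 L0 unfolding \<kappa>_def
    by (intro mult_right_mono power_mono) (auto simp del: of_nat_mult)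
  finally show ?thesis .
qed

lemma success_density_bound:
  fixes F G H :: "(nat \<Rightarrow> 'a::{ab_group_add, finite}) \<Rightarrow> nat \<Rightarrow> circle" and \<alpha> :: "'a \<Rightarrow> circle"
  assumes hom: "\<And>x y. \<alpha> (x + y) = \<alpha> x + \<alpha> y" and x0: "nmul q x0 = 0" "\<alpha> x0 \<noteq> 0"
    and qF: "\<And>x i. i < n \<Longrightarrow> nmul q (F x i) = \<alpha> (x i) + u"
    and S: "S \<subseteq> zero_sum_triples n"
    and win: "\<And>x y z i. (x, y, z) \<in> S \<Longrightarrow> i < n \<Longrightarrow> F x i + G y i + H z i = 0"
    and \<epsilon>: "\<epsilon> > 0" "\<epsilon> * (real (card (UNIV :: 'a set)) ^ n)\<^sup>2 \<le> card S"
  shows "\<epsilon> ^ (6 * q + 1) * real (card (UNIV :: 'a set)) ^ n \<le> 2 * 8192 ^ q * real (card (UNIV :: 'a set) - 1) ^ n"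
proof -
  define M where "M = real (card (UNIV :: 'a set)) ^ n"
  have M0: "M > 0" by (simp add: M_def card_gt_0_iff)
  let ?A = "graph_point n F ` vecs n" and ?B = "graph_point n G ` vecs n"
    and ?C = "uminus ` graph_point n H ` vecs n"
  let ?E = "(\<lambda>(x, y, z). (graph_point n F x, graph_point n G y)) ` S"
  have Svec: "x \<in> vecs n" "y \<in> vecs n" "z \<in> vecs n" "i < n \<Longrightarrow> x i + y i + z i = 0"
    if "(x, y, z) \<in> S" for x y z i
    using S that by (auto simp: zero_sum_triples_def)
  have "inj_on (\<lambda>(x, y, z). (graph_point n F x, graph_point n G y)) S"
  proof (rule inj_onI, clarsimp)
    fix x y z x' y' z' assume s: "(x, y, z) \<in> S" "(x', y', z') \<in> S"
      and eq: "graph_point n F x = graph_point n F x'" "graph_point n G y = graph_point n G y'"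
    have xy: "x = x'" "y = y'"
      using inj_onD[OF inj_on_graph_point[of n F], of x x'] inj_onD[OF inj_on_graph_point[of n G], of y y']
        eq Svec(1,2)[OF s(1)] Svec(1,2)[OF s(2)] by auto
    have "z = z'"
    proof (rule vecs_eqI[OF Svec(3)[OF s(1)] Svec(3)[OF s(2)]])
      fix i assume "i < n"
      then show "z i = z' i" using Svec(4)[OF s(1)] Svec(4)[OF s(2)] xy by (metis add_left_cancel)
    qed
    then show "x = x' \<and> y = y' \<and> z = z'" using xy by simp
  qed
  then have cE: "\<epsilon> * M\<^sup>2 \<le> card ?E" using \<epsilon>(2) by (simp add: card_image M_def)
  \<comment> \<open>In the group coordinate this is the zero-sum condition, in the circle coordinate
    it is \<open>win\<close>.\<close>
  have sum: "a + b \<in> ?C" if ab: "(a, b) \<in> ?E" for a b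
  proof -
    obtain x y z where s: "(x, y, z) \<in> S" "a = graph_point n F x" "b = graph_point n G y"
      using ab by auto
    have "a + b = - graph_point n H z"
    proof
      fix i
      show "(a + b) i = (- graph_point n H z) i"
        using Svec(4)[OF s(1), of i] win[OF s(1), of i]
        by (simp add: s graph_point_def eq_neg_iff_add_eq_0 zero_prod_def)
    qed
    then show ?thesis using Svec(3)[OF s(1)] by blast
  qed
  have cM: "card (f ` vecs n) \<le> M" for f :: "(nat \<Rightarrow> 'a) \<Rightarrow> nat \<Rightarrow> 'a \<times> circle"
    using card_image_le[OF finite_vecs, of f n] by (simp add: M_def card_vecs flip: of_nat_power)
  have "\<exists>A'\<subseteq>?A. card A' \<ge> \<epsilon> * M / 2 \<and> card (A' + uminus ` A') \<le> 8192 / \<epsilon> ^ 6 * card A'"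
  proof (rule balog_szemeredi_gowers[of ?A ?B ?C ?E])
    show "?E \<subseteq> ?A \<times> ?B" using Svec by auto
    show "card ?C \<le> M" using cM by (simp only: image_image)
    show "finite ?A" "finite ?B" "finite ?C" by (intro finite_imageI finite_vecs)+
  qed (fact sum cM cE \<epsilon>(1) M0)+
  then obtain A' where A': "A' \<subseteq> ?A" "\<epsilon> * M / 2 \<le> card A'"
      "card (A' + uminus ` A') \<le> 8192 / \<epsilon> ^ 6 * card A'"
    by blast
  have finA: "finite A'" using A'(1) finite_vecs finite_subset by blast
  have "card A' > 0" using A'(2) \<epsilon>(1) M0 by (smt (verit) divide_pos_pos mult_pos_pos of_nat_0_less_iff)
  then have "A' \<noteq> {}" by auto
  \<comment> \<open>Pluennecke is applied to \<open>A'\<close> and its negative, whose sumset is the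
    difference set bounded above.\<close>
  then obtain X where X: "X \<subseteq> A'" "X \<noteq> {}"
    "card (X + nmul q (uminus ` A')) \<le> (8192 / \<epsilon> ^ 6) ^ q * card X"
    using pluennecke[OF finA _ _ A'(3)] finA by auto
  have cX: "card X > 0" using X(1,2) finA finite_subset by (auto simp: card_gt_0_iff)
  define Y where "Y = {x\<in>vecs n. graph_point n F x \<in> A'}"
  have YA: "graph_point n F ` Y = A'" using A'(1) by (auto simp: Y_def)
  have Yv: "Y \<subseteq> vecs n" by (auto simp: Y_def)
  have "card Y = card A'"
    using card_image[OF inj_on_subset[OF inj_on_graph_point Yv, of F]] YA by simp
  moreover have "card Y \<le> real (card (UNIV :: 'a set) - 1) ^ n * (8192 / \<epsilon> ^ 6) ^ q"
  proof (rule card_le_fibre_values[OF hom x0 Yv])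
    fix w :: "nat \<Rightarrow> 'a" assume w: "w \<in> vecs n"
    let ?V = "(\<lambda>x. \<lambda>i\<in>{..<n}. \<alpha> (x i)) ` {x\<in>Y. \<forall>i<n. nmul q (x i) = w i}"
    have "card X * card ?V \<le> card (X + nmul q (uminus ` A'))"
      using card_fibre_values_le[of n q F \<alpha> u X Y w] qF Yv w X(1) A'(1) YA by auto
    then have "real (card X * card ?V) \<le> card (X + nmul q (uminus ` A'))" by (rule of_nat_mono)
    then have "real (card X * card ?V) \<le> (8192 / \<epsilon> ^ 6) ^ q * card X" using X(3) by (rule order_trans)
    then show "card ?V \<le> (8192 / \<epsilon> ^ 6) ^ q" using cX by (simp add: mult.commute)
  qed
  ultimately have "\<epsilon> * M / 2 \<le> real (card (UNIV :: 'a set) - 1) ^ n * (8192 / \<epsilon> ^ 6) ^ q"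
    using A'(2) by linarith
  also have "\<dots> = real (card (UNIV :: 'a set) - 1) ^ n * 8192 ^ q / \<epsilon> ^ (6 * q)"
    by (simp add: power_divide power_mult)
  finally show ?thesis using \<epsilon>(1) by (simp add: field_simps M_def)
qed

section \<open>Success probabilities\<close>

lemma card_zero_sum_triples:
  "card (zero_sum_triples n :: ((nat \<Rightarrow> 'a::{ab_group_add, finite}) \<times> (nat \<Rightarrow> 'a) \<times> (nat \<Rightarrow> 'a)) set)
    = (card (UNIV :: 'a set) ^ n)\<^sup>2"
proof -
  have "bij_betw (\<lambda>(x, y, z). (x, y)) (zero_sum_triples n) (vecs n \<times> (vecs n :: (nat \<Rightarrow> 'a) set))"
  proof (rule bij_betwI[of _ _ _ "\<lambda>(x, y). (x, y, \<lambda>i\<in>{..<n}. - (x i + y i))"])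
    show "(\<lambda>(x, y, z). (x, y)) \<in> zero_sum_triples n \<rightarrow> vecs n \<times> (vecs n :: (nat \<Rightarrow> 'a) set)"
      by (auto simp: zero_sum_triples_def)
    show "(\<lambda>(x, y). (x, y, \<lambda>i\<in>{..<n}. - (x i + y i))) \<in> vecs n \<times> (vecs n :: (nat \<Rightarrow> 'a) set) \<rightarrow> zero_sum_triples n"
      by (auto simp: zero_sum_triples_def restrict_in_vecs)
    fix s :: "(nat \<Rightarrow> 'a) \<times> (nat \<Rightarrow> 'a) \<times> (nat \<Rightarrow> 'a)" assume "s \<in> zero_sum_triples n"
    then obtain x y z where s: "s = (x, y, z)" "z \<in> vecs n" "\<And>i. i < n \<Longrightarrow> x i + y i + z i = 0"
      by (auto simp: zero_sum_triples_def)
    have "(\<lambda>i\<in>{..<n}. - (x i + y i)) = z"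
    proof (rule vecs_eqI[OF _ s(2)])
      show "(\<lambda>i\<in>{..<n}. - (x i + y i)) \<in> vecs n" by (rule restrict_in_vecs)
      fix i assume "i < n"
      then show "(\<lambda>i\<in>{..<n}. - (x i + y i)) i = z i"
        using minus_unique[OF s(3), of i] by (simp del: minus_add_distrib)
    qed
    then show "(case case s of (x, y, z) \<Rightarrow> (x, y) of (x, y) \<Rightarrow> (x, y, \<lambda>i\<in>{..<n}. - (x i + y i))) = s"
      by (simp add: s(1))
  qed auto
  then show ?thesis by (simp add: bij_betw_same_card card_cartesian_product card_vecs power2_eq_square)
qed

text \<open>If every triple succeeded, constant vectors read at coordinate 0 would solve the problem
  modulo \<open>p ^ k\<close> itself. So at least one triple fails.\<close>

lemma success_prob_le:
  fixes t :: "'a::{ab_group_add, finite} \<Rightarrow> 'a \<Rightarrow> 'a \<Rightarrow> int"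
  assumes n: "n > 0" and not_adm: "\<not> admissible_N p k t 1"
  shows "success_prob p k t n f g h \<le> 1 - 1 / (real (card (UNIV :: 'a set)) ^ n)\<^sup>2"
proof -
  let ?T = "zero_sum_triples n :: ((nat \<Rightarrow> 'a) \<times> (nat \<Rightarrow> 'a) \<times> (nat \<Rightarrow> 'a)) set"
  let ?S = "{(x, y, z) \<in> ?T. \<forall>i<n. [f x i + g y i + h z i = t (x i) (y i) (z i)] (mod int (p ^ k))}"
  define M where "M = (card (UNIV :: 'a set) ^ n)\<^sup>2"
  have M: "card ?T = M" "M > 0" by (simp_all add: card_zero_sum_triples M_def card_gt_0_iff)
  have fin: "finite ?T" using M card_ge_0_finite by metis
  have "?S \<noteq> ?T"
  proof
    assume eq: "?S = ?T"
    define e where "e s = (\<lambda>i\<in>{..<n}. s)" for s :: 'a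
    have "[f (e x) 0 + g (e y) 0 + h (e z) 0 = t x y z] (mod int (p ^ k))" if "x + y + z = 0" for x y z
    proof -
      have "(e x, e y, e z) \<in> ?T" using that by (simp add: zero_sum_triples_def restrict_in_vecs e_def)
      then have "(e x, e y, e z) \<in> ?S" using eq by simp
      then have "[f (e x) 0 + g (e y) 0 + h (e z) 0 = t (e x 0) (e y 0) (e z 0)] (mod int (p ^ k))"
        using n by blast
      then show ?thesis using n by (simp add: e_def)
    qed
    then have "admissible_N p k t 1"
      unfolding admissible_N_def
      by (intro exI[of _ "\<lambda>x. f (e x) 0"] exI[of _ "\<lambda>x. g (e x) 0"] exI[of _ "\<lambda>x. h (e x) 0"]) simp
    then show False using not_adm by simp
  qed
  then have "card ?S < card ?T" using fin by (intro psubset_card_mono) auto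
  then have "real (card ?S) \<le> real M - 1" using M by linarith
  then have "real (card ?S) / M \<le> (real M - 1) / M" using M by (intro divide_right_mono) auto
  also have "\<dots> = 1 - 1 / M" using M by (simp add: field_simps)
  finally show ?thesis unfolding success_prob_def M(1) by (simp add: M_def)
qed

lemma success_prob_power_le:
  fixes t :: "'a::{ab_group_add, finite} \<Rightarrow> 'a \<Rightarrow> 'a \<Rightarrow> int"
  assumes p: "p > 0" and N: "N > 0" "admissible_N p k t N" and not_adm: "\<not> admissible_N p k t 1"
  shows "success_prob p k t n f g h ^ (6 * p ^ k + 1) * real (card (UNIV :: 'a set)) ^ n
    \<le> 2 * 8192 ^ (p ^ k) * real (card (UNIV :: 'a set) - 1) ^ n"
proof -
  define q where "q = p ^ k"
  have q: "q > 0" using p by (simp add: q_def)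
  obtain a b c :: "'a \<Rightarrow> int" where abc:
    "\<And>x y z. x + y + z = 0 \<Longrightarrow> [a x + b y + c z = int N * t x y z] (mod int (q * N))"
    using N(2) unfolding admissible_N_def q_def by blast
  \<comment> \<open>Division by \<open>q N\<close> turns the congruences into circle equations, and
    \<open>N\<close> cancels on the right.\<close>
  define lift where "lift r s = circ (of_int (r s) / real (q * N))" for r :: "'a \<Rightarrow> int" and s
  have qN: "q * N > 0" using q N(1) by simp
  have sol: "lift a x + lift b y + lift c z = circ (of_int (t x y z) / real q)" if "x + y + z = 0" for x y z
  proof -
    have "lift a x + lift b y + lift c z = circ (of_int (a x + b y + c z) / real (q * N))"
      unfolding lift_def by (simp only: of_int_add add_divide_distrib circ_add)
    also have "\<dots> = circ (of_int (int N * t x y z) / real (q * N))"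
      using circ_div_eq_iff[OF qN] abc[OF that] by blast
    also have "of_int (int N * t x y z) / real (q * N) = of_int (t x y z) / real q"
      using N(1) by simp
    finally show ?thesis .
  qed
  have "\<not> (\<exists>a b c :: 'a \<Rightarrow> int. \<forall>x y z. x + y + z = 0 \<longrightarrow> [a x + b y + c z = t x y z] (mod int q))"
    using not_adm unfolding admissible_N_def q_def by simp
  then obtain \<alpha> u x0 where \<alpha>: "\<And>x y. \<alpha> (x + y) = \<alpha> x + \<alpha> y" "\<And>x. nmul q (lift a x) = \<alpha> x + u"
    "nmul q x0 = 0" "\<alpha> x0 \<noteq> 0"
    using torsion_obstruction[of q "lift a" "lift b" "lift c" t] q sol by blast
  define F where "F r e x i = lift r (x i) - circ (of_int (e x i) / real q)"
    for r and e :: "(nat \<Rightarrow> 'a) \<Rightarrow> nat \<Rightarrow> int" and x i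
  \<comment> \<open>The outputs of \<open>f\<close> disappear because \<open>q\<close> times a
    multiple of \<open>1 / q\<close> is an integer.\<close>
  have qF: "nmul q (F a f x i) = \<alpha> (x i) + u" for x i
    using q \<alpha>(2) circ_eq_0_iff by (simp add: F_def nmul_diff nmul_circ)
  define S where "S = {(x, y, z) \<in> zero_sum_triples n.
    \<forall>i<n. [f x i + g y i + h z i = t (x i) (y i) (z i)] (mod int q)}"
  have win: "F a f x i + F b g y i + F c h z i = 0" if "(x, y, z) \<in> S" "i < n" for x y z i
  proof -
    have "circ (of_int (f x i + g y i + h z i) / real q) = circ (of_int (t (x i) (y i) (z i)) / real q)"
      using that unfolding S_def circ_div_eq_iff[OF q] by blast
    moreover have "x i + y i + z i = 0" using that by (auto simp: S_def zero_sum_triples_def)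
    ultimately show ?thesis using sol[of "x i" "y i" "z i"]
      by (simp add: F_def add_divide_distrib circ_add algebra_simps)
  qed
  define \<epsilon> where "\<epsilon> = success_prob p k t n f g h"
  have \<epsilon>: "\<epsilon> * (real (card (UNIV :: 'a set)) ^ n)\<^sup>2 = card S"
    unfolding \<epsilon>_def success_prob_def card_zero_sum_triples S_def q_def by simp
  have "\<epsilon> \<ge> 0" by (simp add: \<epsilon>_def success_prob_def)
  show ?thesis
  proof (cases "\<epsilon> = 0")
    case True
    then show ?thesis by (simp flip: \<epsilon>_def)
  next
    case False
    then have "\<epsilon> > 0" using \<open>\<epsilon> \<ge> 0\<close> by simp
    then show ?thesis
      using success_density_bound[of \<alpha> q x0 n "F a f" u S "F b g" "F c h" \<epsilon>] \<alpha> qF win \<epsilon>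
      by (auto simp: S_def q_def[symmetric] \<epsilon>_def[symmetric])
  qed
qed

text \<open>The power bound decides large \<open>n\<close>; the finitely many small \<open>n\<close> only need a bound below 1.\<close>

lemma exponential_bound:
  fixes P :: "nat \<Rightarrow> real \<Rightarrow> bool" and \<rho> D :: real
  assumes \<rho>: "0 < \<rho>" "\<rho> < 1" and d: "d > 0"
    and large: "\<And>n \<epsilon>. P n \<epsilon> \<Longrightarrow> \<epsilon> ^ d \<le> D * \<rho> ^ n"
    and small: "\<And>n \<epsilon>. n > 0 \<Longrightarrow> P n \<epsilon> \<Longrightarrow> \<epsilon> \<le> \<delta> n" "\<And>n. \<delta> n < 1"
    and zero: "\<And>\<epsilon>. P 0 \<epsilon> \<Longrightarrow> \<epsilon> \<le> 1"
  shows "\<exists>c>0. \<forall>n \<epsilon>. P n \<epsilon> \<longrightarrow> \<epsilon> \<le> 2 powr (- c * real n)"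
proof -
  \<comment> \<open>One factor \<open>\<sigma> ^ n\<close> absorbs \<open>D\<close> for large
    \<open>n\<close>; the other is the decay that remains.\<close>
  define \<sigma> where "\<sigma> = sqrt \<rho>"
  have \<sigma>: "0 < \<sigma>" "\<sigma> < 1" "\<rho> = \<sigma> * \<sigma>" using \<rho> by (auto simp: \<sigma>_def)
  have "(\<lambda>n. D * \<sigma> ^ n) \<longlonglongrightarrow> D * 0"
    using \<sigma> by (intro tendsto_mult tendsto_const LIMSEQ_power_zero) auto
  then have "\<forall>\<^sub>F n in sequentially. D * \<sigma> ^ n < 1" by (rule order_tendstoD) simp
  then obtain n0 where n0: "\<And>n. n \<ge> n0 \<Longrightarrow> D * \<sigma> ^ n < 1" by (auto simp: eventually_sequentially)
  define m where "m = Suc n0"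
  \<comment> \<open>Including 1/2 keeps \<open>\<eta>\<close> positive, so that its logarithm can
    define \<open>c2\<close>.\<close>
  define \<eta> where "\<eta> = Max (insert (1 / 2) (\<delta> ` {..m}))"
  have \<eta>: "1 / 2 \<le> \<eta>" "\<eta> < 1" using small(2) by (auto simp: \<eta>_def)
  have \<delta>: "\<delta> n \<le> \<eta>" if "n \<le> m" for n unfolding \<eta>_def using that by (intro Max_ge) auto
  define c1 where "c1 = - log 2 \<sigma> / d"
  define c2 where "c2 = - log 2 \<eta> / m"
  define c where "c = min c1 c2"
  have c12: "c1 > 0" "c2 > 0" using \<sigma> \<eta> d by (auto simp: c1_def c2_def m_def divide_neg_pos)
  have "\<epsilon> \<le> 2 powr (- c * real n)" if P: "P n \<epsilon>" for n \<epsilon>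
  proof -
    consider "n = 0" | "n > 0" "n \<le> m" | "n \<ge> n0" unfolding m_def by linarith
    then show ?thesis
    proof cases
      case 1
      then show ?thesis using zero P by simp
    next
      case 2
      then have "\<epsilon> \<le> \<eta>" using small(1)[OF _ P] \<delta>[of n] by simp
      also have "\<eta> = 2 powr (- c2 * m)" using \<eta> by (simp add: c2_def m_def)
      also have "\<dots> \<le> 2 powr (- c * real n)"
      proof -
        have "c * real n \<le> c2 * m" using 2 c12 by (intro mult_mono) (auto simp: c_def)
        then show ?thesis by simp
      qed
      finally show ?thesis .
    next
      case 3
      have "\<epsilon> ^ d \<le> (D * \<sigma> ^ n) * \<sigma> ^ n" using large[OF P] \<sigma>(3) by (simp add: power_mult_distrib)
      also have "\<dots> \<le> 1 * \<sigma> ^ n" using n0[OF 3] \<sigma> by (intro mult_right_mono) auto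
      also have "\<dots> = (2 powr (- c1 * real n)) ^ d"
      proof -
        have "(2 powr (- c1 * real n)) ^ d = 2 powr (log 2 \<sigma> * real n)"
          using d by (simp add: c1_def powr_power)
        also have "\<dots> = \<sigma> ^ n" using \<sigma> by (simp add: powr_realpow flip: powr_powr)
        finally show ?thesis by simp
      qed
      finally have "\<epsilon> \<le> 2 powr (- c1 * real n)"
        by (metis d power_le_imp_le_base powr_ge_zero Suc_pred)
      also have "\<dots> \<le> 2 powr (- c * real n)" by (simp add: c_def mult_right_mono)
      finally show ?thesis .
    qed
  qed
  moreover have "c > 0" using c12 by (simp add: c_def)
  ultimately show ?thesis by blast
qed

theorem theorem2p4:
  fixes t :: "'a::{ab_group_add, finite} \<Rightarrow> 'a \<Rightarrow> 'a \<Rightarrow> int"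
    and p k :: nat
  assumes "prime p" and "k \<ge> 1"
    and "\<exists>N>0. admissible_N p k t N"
    and "(LEAST N. N > 0 \<and> admissible_N p k t N) > 1"
  shows "\<exists>c>0. \<forall>n f g h. success_prob p k t n f g h \<le> 2 powr (- c * real n)"
proof -
  obtain N where N: "N > 0" "admissible_N p k t N" using assms(3) by blast
  have not_adm: "\<not> admissible_N p k t 1"
    using assms(4) not_less_Least[of 1 "\<lambda>N. N > 0 \<and> admissible_N p k t N"] by simp
  have p: "p > 0" using assms(1) by (simp add: prime_gt_0_nat)
  let ?A = "real (card (UNIV :: 'a set))" and ?A1 = "real (card (UNIV :: 'a set) - 1)"
  have A0: "?A > 0" by (simp add: card_gt_0_iff)
  \<comment> \<open>A trivial group has a single triple, so \<open>N = 1\<close> would work;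
    excluding it makes the ratio \<open>?A1 / ?A\<close> positive.\<close>
  have "card (UNIV :: 'a set) \<noteq> 1"
  proof
    assume "card (UNIV :: 'a set) = 1"
    then have "x = (0 :: 'a)" for x by (metis UNIV_I card_1_singletonE singletonD)
    then have "x = y" for x y :: 'a by metis
    then have "[t 0 0 0 + 0 + 0 = int 1 * t x y z] (mod int (p ^ k * 1))" for x y z
      by (metis add.right_neutral cong_refl mult_1 of_nat_1)
    then have "admissible_N p k t 1"
      unfolding admissible_N_def
      by (intro exI[of _ "\<lambda>_. t 0 0 0"] exI[of _ "\<lambda>_. 0"]) blast
    then show False using not_adm by simp
  qed
  then have A: "card (UNIV :: 'a set) > 1" using A0 by linarith
  \<comment> \<open>Speaking of attained probabilities instead of \<open>f\<close>,
    \<open>g\<close>, \<open>h\<close> makes the constant uniform over all of them.\<close>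
  define P where "P n \<epsilon> \<longleftrightarrow> (\<exists>f g h. \<epsilon> = success_prob p k t n f g h)" for n \<epsilon>
  have "\<exists>c>0. \<forall>n \<epsilon>. P n \<epsilon> \<longrightarrow> \<epsilon> \<le> 2 powr (- c * real n)"
  proof (rule exponential_bound)
    show "0 < ?A1 / ?A" "?A1 / ?A < 1" using A by auto
    show "6 * p ^ k + 1 > 0" by simp
    show "\<epsilon> ^ (6 * p ^ k + 1) \<le> 2 * 8192 ^ (p ^ k) * (?A1 / ?A) ^ n" if "P n \<epsilon>" for n \<epsilon>
    proof -
      have "\<epsilon> ^ (6 * p ^ k + 1) * ?A ^ n \<le> 2 * 8192 ^ (p ^ k) * ?A1 ^ n"
        using that success_prob_power_le[OF p N not_adm] by (auto simp: P_def)
      then show ?thesis using A0 by (simp add: power_divide pos_le_divide_eq)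
    qed
    show "\<epsilon> \<le> 1 - 1 / (?A ^ n)\<^sup>2" if "n > 0" "P n \<epsilon>" for n \<epsilon>
      using that success_prob_le[OF _ not_adm] by (auto simp: P_def)
    show "1 - 1 / (?A ^ n)\<^sup>2 < 1" for n using A0 by simp
    show "\<epsilon> \<le> 1" if "P 0 \<epsilon>" for \<epsilon>
    proof -
      have "success_prob p k t 0 f g h \<le> 1" for f g h
        unfolding success_prob_def by (intro divide_le_eq_1_pos[THEN iffD2] of_nat_mono card_mono)
          (auto simp: card_zero_sum_triples intro: card_ge_0_finite)
      then show ?thesis using that by (auto simp: P_def)
    qed
  qed
  then show ?thesis unfolding P_def by blast
qed

end
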